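(* Let $G$ be a $\sigma$-compact principal étale groupoid with compact and totally disconnected unit space, and let $\mathcal{E}_G$ be the canonical coarse structure on $G$. Then $$\mathrm{asdim}(G,\mathcal{E}_G)\leq \mathrm{dad}(G).$$ If we further assume $\mathrm{dad}(G)<\infty$, then $$\mathrm{dad}(G)=\mathrm{asdim}(G,\mathcal{E}_G).$$
   Context: All groupoids are locally compact, Hausdorff and étale (the range and source maps $r,s\colon G\to G^0$ are local homeomorphisms), where $G^0$ is the unit space. $G$ is principal if every $g\in G$ with $r(g)=s(g)$ is a unit. For $A\subseteq G^0$, $G|_A=\{g\in G\mid s(g),r(g)\in A\}$. For $K\subseteq G$, $\langle K\rangle$ denotes the subgroupoid of $G$ generated by $K$. A subset is relatively compact if its closure is compact. Dynamic asymptotic dimension: for $d\in\mathbb{N}=\{0,1,2,\ldots\}$, $G$ has dynamic asymptotic dimension at most $d$ if for every open relatively compact subset $K\subseteq G$ there is a cover of $s(K)\cup r(K)$ by $d+1$ open sets $U_0,\ldots,U_d\subseteq G^0$ such that for each $0\leq i\leq d$ the groupoid $\langle K\cap G|_{U_i}\rangle$ is relatively compact in $G$. $\mathrm{dad}(G)$ is the smallest such $d$, and $\mathrm{dad}(G)=\infty$ if no such $d$ exists. Canonical coarse structure: $\mathcal{E}_G$ is the collection of all subsets $E\subseteq\{(g,h)\in G\times G\mid r(g)=r(h)\}$ for which there is an open relatively compact subset $K\subseteq G$ with $E\subseteq\{(g,h)\mid r(g)=r(h),\ g^{-1}h\in K\}\cup\Delta_G$, where $\Delta_G$ is the diagonal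 of $G\times G$. The elements of $\mathcal{E}_G$ are called controlled sets. Asymptotic dimension: let $(X,\mathcal{E})$ be a coarse space and $E\in\mathcal{E}$ a controlled set. A family $\{U_i\}_{i\in I}$ of subsets of $X$ is $E$-separated if $(U_i\times U_j)\cap E=\emptyset$ for all $i\neq j$, and $E$-bounded if $U_i\times U_i\subseteq E$ for all $i\in I$. $\mathrm{asdim}(X,\mathcal{E})$ is the smallest $d\in\mathbb{N}$ such that for every controlled set $E$ there exist a controlled set $F$ and an $F$-bounded cover $\mathcal{U}$ of $X$ admitting a decomposition $\mathcal{U}=\mathcal{U}_0\sqcup\cdots\sqcup\mathcal{U}_d$ with each $\mathcal{U}_i$ $E$-separated; it is $\infty$ if no such $d$ exists. *)

theory Defs
  imports "HOL-Analysis.Analysis" "HOL-Library.Extended_Nat" "HOL-Library.Disjoint_Sets"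
begin

section \<open>Topology\<close>

definition sigma_compact_space :: "'a topology \<Rightarrow> bool" where
  "sigma_compact_space X \<longleftrightarrow>
     (\<exists>\<K>. countable \<K> \<and> (\<forall>C\<in>\<K>. compactin X C) \<and> \<Union>\<K> = topspace X)"

definition totally_disconnected_space :: "'a topology \<Rightarrow> bool" where
  "totally_disconnected_space X \<longleftrightarrow> (\<forall>S. connectedin X S \<longrightarrow> (\<exists>a. S \<subseteq> {a}))"

definition relatively_compactin :: "'a topology \<Rightarrow> 'a set \<Rightarrow> bool" where
  "relatively_compactin X S \<longleftrightarrow> S \<subseteq> topspace X \<and> compactin X (X closure_of S)"

definition local_homeomorphism :: "'a topology \<Rightarrow> 'b topology \<Rightarrow> ('a \<Rightarrow> 'b) \<Rightarrow> bool" where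
  "local_homeomorphism X Y f \<longleftrightarrow>
     (\<forall>x\<in>topspace X. \<exists>U. x \<in> U \<and> openin X U \<and> openin Y (f ` U) \<and>
        homeomorphic_map (subtopology X U) (subtopology Y (f ` U)) f)"

section \<open>Groupoids\<close>

text \<open>The underlying set of the groupoid is the underlying set of the topology \<open>gtop G\<close>.
  The value \<open>gmult G g h\<close> is meaningful only if \<open>src G g = rng G h\<close>, and units are identified
  with their identity arrows.\<close>

record 'a groupoid =
  gtop :: "'a topology"
  src :: "'a \<Rightarrow> 'a"
  rng :: "'a \<Rightarrow> 'a"
  gmult :: "'a \<Rightarrow> 'a \<Rightarrow> 'a"
  ginv :: "'a \<Rightarrow> 'a"

abbreviation arrows :: "'a groupoid \<Rightarrow> 'a set" where
  "arrows G \<equiv> topspace (gtop G)"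

definition units :: "'a groupoid \<Rightarrow> 'a set" where
  "units G = src G ` arrows G"

abbreviation unit_space :: "'a groupoid \<Rightarrow> 'a topology" where
  "unit_space G \<equiv> subtopology (gtop G) (units G)"

definition composable :: "'a groupoid \<Rightarrow> ('a \<times> 'a) set" where
  "composable G = {(g, h). g \<in> arrows G \<and> h \<in> arrows G \<and> src G g = rng G h}"

locale groupoid =
  fixes G :: "'a groupoid"
  assumes src_closed: "g \<in> arrows G \<Longrightarrow> src G g \<in> arrows G"
    and rng_closed: "g \<in> arrows G \<Longrightarrow> rng G g \<in> arrows G"
    and src_src: "g \<in> arrows G \<Longrightarrow> src G (src G g) = src G g"
    and rng_src: "g \<in> arrows G \<Longrightarrow> rng G (src G g) = src G g"
    and src_rng: "g \<in> arrows G \<Longrightarrow> src G (rng G g) = rng G g"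
    and rng_rng: "g \<in> arrows G \<Longrightarrow> rng G (rng G g) = rng G g"
    and mult_closed: "(g, h) \<in> composable G \<Longrightarrow> gmult G g h \<in> arrows G"
    and src_mult: "(g, h) \<in> composable G \<Longrightarrow> src G (gmult G g h) = src G h"
    and rng_mult: "(g, h) \<in> composable G \<Longrightarrow> rng G (gmult G g h) = rng G g"
    and mult_assoc: "\<lbrakk>(g, h) \<in> composable G; (h, k) \<in> composable G\<rbrakk> \<Longrightarrow>
          gmult G (gmult G g h) k = gmult G g (gmult G h k)"
    and mult_src: "g \<in> arrows G \<Longrightarrow> gmult G g (src G g) = g"
    and rng_mult_left: "g \<in> arrows G \<Longrightarrow> gmult G (rng G g) g = g"
    and inv_closed: "g \<in> arrows G \<Longrightarrow> ginv G g \<in> arrows G"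
    and src_inv: "g \<in> arrows G \<Longrightarrow> src G (ginv G g) = rng G g"
    and rng_inv: "g \<in> arrows G \<Longrightarrow> rng G (ginv G g) = src G g"
    and inv_mult: "g \<in> arrows G \<Longrightarrow> gmult G (ginv G g) g = src G g"
    and mult_inv: "g \<in> arrows G \<Longrightarrow> gmult G g (ginv G g) = rng G g"

locale topological_groupoid = groupoid +
  assumes continuous_mult:
      "continuous_map (subtopology (prod_topology (gtop G) (gtop G)) (composable G)) (gtop G)
         (\<lambda>(g, h). gmult G g h)"
    and continuous_inv: "continuous_map (gtop G) (gtop G) (ginv G)"

locale etale_groupoid = topological_groupoid +
  assumes locally_compact: "locally_compact_space (gtop G)"
    and Hausdorff: "Hausdorff_space (gtop G)"
    and local_homeomorphism_src: "local_homeomorphism (gtop G) (unit_space G) (src G)"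
    and local_homeomorphism_rng: "local_homeomorphism (gtop G) (unit_space G) (rng G)"

definition principal_groupoid :: "'a groupoid \<Rightarrow> bool" where
  "principal_groupoid G \<longleftrightarrow> (\<forall>g\<in>arrows G. rng G g = src G g \<longrightarrow> g \<in> units G)"

definition restriction :: "'a groupoid \<Rightarrow> 'a set \<Rightarrow> 'a set" where
  "restriction G A = {g \<in> arrows G. src G g \<in> A \<and> rng G g \<in> A}"

text \<open>Closure under products and inverses implies closure under source and range. A subgroupoid
  need not contain all units of \<open>G\<close>.\<close>

definition subgroupoid :: "'a groupoid \<Rightarrow> 'a set \<Rightarrow> bool" where
  "subgroupoid G H \<longleftrightarrow> H \<subseteq> arrows G \<and> (\<forall>g\<in>H. ginv G g \<in> H) \<and>
     (\<forall>g\<in>H. \<forall>h\<in>H. src G g = rng G h \<longrightarrow> gmult G g h \<in> H)"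

definition generated_subgroupoid :: "'a groupoid \<Rightarrow> 'a set \<Rightarrow> 'a set" where
  "generated_subgroupoid G K = subgroupoid G hull K"

section \<open>Dynamic asymptotic dimension\<close>

definition dad_at_most :: "'a groupoid \<Rightarrow> nat \<Rightarrow> bool" where
  "dad_at_most G d \<longleftrightarrow>
     (\<forall>K. openin (gtop G) K \<and> relatively_compactin (gtop G) K \<longrightarrow>
        (\<exists>U :: nat \<Rightarrow> 'a set.
           (\<forall>i\<le>d. openin (unit_space G) (U i)) \<and>
           src G ` K \<union> rng G ` K \<subseteq> (\<Union>i\<le>d. U i) \<and>
           (\<forall>i\<le>d. relatively_compactin (gtop G)
              (generated_subgroupoid G (K \<inter> restriction G (U i))))))"

text \<open>The infimum of the empty set is \<open>\<infinity>\<close> in \<open>enat\<close>; otherwise the infimum is attained.\<close>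

definition dad :: "'a groupoid \<Rightarrow> enat" where
  "dad G = (INF d\<in>{d. dad_at_most G d}. enat d)"

section \<open>Coarse structures and asymptotic dimension\<close>

definition canonical_coarse_structure :: "'a groupoid \<Rightarrow> ('a \<times> 'a) set set" where
  "canonical_coarse_structure G =
     {E. E \<subseteq> {(g, h). g \<in> arrows G \<and> h \<in> arrows G \<and> rng G g = rng G h} \<and>
         (\<exists>K. openin (gtop G) K \<and> relatively_compactin (gtop G) K \<and>
            E \<subseteq> {(g, h). g \<in> arrows G \<and> h \<in> arrows G \<and> rng G g = rng G h \<and>
                           gmult G (ginv G g) h \<in> K}
                 \<union> Id_on (arrows G))}"

definition separated_family :: "('a \<times> 'a) set \<Rightarrow> 'a set set \<Rightarrow> bool" where
  "separated_family E \<U> \<longleftrightarrow> (\<forall>U\<in>\<U>. \<forall>V\<in>\<U>. U \<noteq> V \<longrightarrow> (U \<times> V) \<inter> E = {})"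

definition bounded_family :: "('a \<times> 'a) set \<Rightarrow> 'a set set \<Rightarrow> bool" where
  "bounded_family E \<U> \<longleftrightarrow> (\<forall>U\<in>\<U>. U \<times> U \<subseteq> E)"

definition asdim_at_most :: "'a set \<Rightarrow> ('a \<times> 'a) set set \<Rightarrow> nat \<Rightarrow> bool" where
  "asdim_at_most X \<E> d \<longleftrightarrow>
     (\<forall>E\<in>\<E>. \<exists>F\<in>\<E>. \<exists>\<U>. \<Union>\<U> = X \<and> bounded_family F \<U> \<and>
        (\<exists>\<D> :: nat \<Rightarrow> 'a set set. \<U> = (\<Union>i\<le>d. \<D> i) \<and> disjoint_family_on \<D> {..d} \<and>
           (\<forall>i\<le>d. separated_family E (\<D> i))))"

definition asdim :: "'a set \<Rightarrow> ('a \<times> 'a) set set \<Rightarrow> enat" where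
  "asdim X \<E> = (INF d\<in>{d. asdim_at_most X \<E> d}. enat d)"

end

theory Submission
  imports Defs
begin

text \<open>
  Left translation is invisible to the canonical coarse structure: whether \<open>(g, h)\<close> lies in a
  controlled set is governed by \<open>g\<inverse>h\<close>, an arrow between the points \<open>src h\<close> and \<open>src g\<close> of the
  unit space. Sets of units \<open>U i\<close> therefore correspond to sets of arrows \<open>src -` U i\<close>, and the
  subgroupoid generated by \<open>K \<inter> G|U i\<close> cuts \<open>src -` U i\<close> into its cosets. These cosets are
  separated because an arrow of \<open>K\<close> that joins two of them would belong to the subgroupoid, and they
  are uniformly bounded because the subgroupoid is relatively compact. This is
  \<open>asdim_at_most_if_dad_at_most\<close>.

  The converse has to replace covers of the single range fibres, which are unrelated from one
  unit to the next, by finitely many open sets of units. Let \<open>d\<close> bound the asymptotic dimension and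
  let some finite \<open>N\<close> bound the dynamic one.

  Locally this is a finite colouring problem. Let \<open>K\<close> and \<open>U\<close> be compact open. If \<open>H\<close>, the subgroupoid
  generated by \<open>K \<inter> G|U\<close>, is relatively compact, then its orbits are finite and it is compact open. Since \<open>G\<close> is principal, finitely
  many compact open sets of units suffice to tell apart the points of every \<open>H\<close>-orbit, so the points
  of \<open>U\<close> carry labels from a finite set that are locally constant and injective on orbits. The cover
  of one range fibre supplied by the asymptotic dimension becomes a colouring of the labels with \<open>d + 1\<close>
  colours. There are only finitely many colourings of the labels, and the set of units at which a given one
  works is compact open and \<open>H\<close>-invariant; hence a working colouring can be selected in a
  locally constant, orbitwise constant way (\<open>colouring_from_cover\<close>). The size of the
  coloured pieces is the one provided by the asymptotic dimension for \<open>K\<close>. It depends neither on \<open>U\<close>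
  nor on \<open>H\<close>.

  This independence makes the passage to the whole unit space possible. Coloured pieces for a set
  \<open>V\<close> that are bounded by \<open>B\<close> can be merged with coloured pieces for another set \<open>W\<close>,
  provided the latter are coloured at the coarser scale \<open>K B K\<close> (\<open>gen_glue\<close>); this is the
  usual argument for the union theorem of asymptotic dimension. Starting from \<open>K\<close>, one
  computes \<open>N + 1\<close> growing scales in advance. The bound \<open>N\<close>, used at the
  coarsest of these scales, gives \<open>N + 1\<close> sets \<open>U i\<close> of the kind treated above, and merging their colourings
  one after the other leaves \<open>d + 1\<close> sets (\<open>dad_at_most_if_asdim_at_most\<close>).
\<close>

section \<open>Algebra in a groupoid\<close>

definition set_mult :: "'a groupoid \<Rightarrow> 'a set \<Rightarrow> 'a set \<Rightarrow> 'a set" where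
  "set_mult G A B = {gmult G a b | a b. a \<in> A \<and> b \<in> B \<and> src G a = rng G b}"

context groupoid
begin

abbreviation gm :: "'a \<Rightarrow> 'a \<Rightarrow> 'a" (infixl "\<cdot>" 70) where
  "g \<cdot> h \<equiv> gmult G g h"

abbreviation gen :: "'a set \<Rightarrow> 'a set" where
  "gen K \<equiv> generated_subgroupoid G K"

lemma gm_closed [simp]: "\<lbrakk>g \<in> arrows G; h \<in> arrows G; src G g = rng G h\<rbrakk> \<Longrightarrow> g \<cdot> h \<in> arrows G"
  using mult_closed by (simp add: composable_def)

lemma src_gm [simp]: "\<lbrakk>g \<in> arrows G; h \<in> arrows G; src G g = rng G h\<rbrakk> \<Longrightarrow> src G (g \<cdot> h) = src G h"
  using src_mult by (simp add: composable_def)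

lemma rng_gm [simp]: "\<lbrakk>g \<in> arrows G; h \<in> arrows G; src G g = rng G h\<rbrakk> \<Longrightarrow> rng G (g \<cdot> h) = rng G g"
  using rng_mult by (simp add: composable_def)

lemma gm_assoc: "\<lbrakk>g \<in> arrows G; h \<in> arrows G; k \<in> arrows G; src G g = rng G h; src G h = rng G k\<rbrakk>
    \<Longrightarrow> (g \<cdot> h) \<cdot> k = g \<cdot> (h \<cdot> k)"
  using mult_assoc by (simp add: composable_def)

lemmas groupoid_simps [simp] = src_closed rng_closed src_src rng_src src_rng rng_rng mult_src
  rng_mult_left inv_closed src_inv rng_inv inv_mult mult_inv

lemma inv_gm_cancel [simp]:
  "\<lbrakk>g \<in> arrows G; h \<in> arrows G; src G g = rng G h\<rbrakk> \<Longrightarrow> ginv G g \<cdot> (g \<cdot> h) = h"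
  by (simp flip: gm_assoc)

lemma gm_inv_cancel [simp]:
  "\<lbrakk>g \<in> arrows G; h \<in> arrows G; rng G g = rng G h\<rbrakk> \<Longrightarrow> g \<cdot> (ginv G g \<cdot> h) = h"
  by (simp flip: gm_assoc)

lemma inv_unique:
  assumes "g \<in> arrows G" "h \<in> arrows G" "src G g = rng G h" "g \<cdot> h = rng G g"
  shows "ginv G g = h"
  using assms inv_gm_cancel[of g h] mult_src[of "ginv G g"] by simp

lemma inv_inv [simp]: "g \<in> arrows G \<Longrightarrow> ginv G (ginv G g) = g"
  by (rule inv_unique) simp_all

lemma inv_gm: 
  assumes "g \<in> arrows G" "h \<in> arrows G" "src G g = rng G h"
  shows "ginv G (g \<cdot> h) = ginv G h \<cdot> ginv G g"
  by (rule inv_unique) (use assms in \<open>auto simp: gm_assoc\<close>)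

lemma units_arrows: "u \<in> units G \<Longrightarrow> u \<in> arrows G"
  unfolding units_def using src_closed by blast

lemma src_unit [simp]: "u \<in> units G \<Longrightarrow> src G u = u"
  by (metis imageE src_src units_def)

lemma rng_unit [simp]: "u \<in> units G \<Longrightarrow> rng G u = u"
  by (metis imageE rng_src units_def)

lemma src_in_units [simp]: "g \<in> arrows G \<Longrightarrow> src G g \<in> units G"
  unfolding units_def by (rule imageI)

lemma rng_in_units [simp]: "g \<in> arrows G \<Longrightarrow> rng G g \<in> units G"
  by (metis src_in_units rng_closed src_rng)

lemma unit_gm_unit: "u \<in> units G \<Longrightarrow> u \<cdot> u = u"
  by (metis mult_src src_unit units_arrows)

lemma inv_unit [simp]: "u \<in> units G \<Longrightarrow> ginv G u = u"
  by (intro inv_unique) (simp_all add: units_arrows unit_gm_unit)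

lemma restriction_subset_arrows: "restriction G A \<subseteq> arrows G"
  by (auto simp: restriction_def)

lemma subgroupoid_Inter:
  assumes "\<And>H. H \<in> \<H> \<Longrightarrow> subgroupoid G H" "\<H> \<noteq> {}"
  shows "subgroupoid G (\<Inter>\<H>)"
  using assms unfolding subgroupoid_def by blast

lemma subgroupoid_arrows: "subgroupoid G (arrows G)"
  by (auto simp: subgroupoid_def)

lemma subgroupoid_restriction: "subgroupoid G (restriction G A)"
  by (auto simp: subgroupoid_def restriction_def)

lemma subgroupoid_gen:
  assumes "K \<subseteq> arrows G" shows "subgroupoid G (gen K)"
  unfolding generated_subgroupoid_def hull_def
  by (rule subgroupoid_Inter) (use assms subgroupoid_arrows in auto)

lemma subset_gen: "K \<subseteq> gen K"
  by (simp add: generated_subgroupoid_def hull_subset)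

lemma gen_minimal: "\<lbrakk>K \<subseteq> H; subgroupoid G H\<rbrakk> \<Longrightarrow> gen K \<subseteq> H"
  by (simp add: generated_subgroupoid_def hull_minimal)

lemma gen_mono: "K \<subseteq> K' \<Longrightarrow> gen K \<subseteq> gen K'"
  by (simp add: generated_subgroupoid_def hull_mono)

lemma subgroupoid_gm: "\<lbrakk>subgroupoid G H; g \<in> H; h \<in> H; src G g = rng G h\<rbrakk> \<Longrightarrow> g \<cdot> h \<in> H"
  unfolding subgroupoid_def by blast

lemma subgroupoid_inv: "\<lbrakk>subgroupoid G H; g \<in> H\<rbrakk> \<Longrightarrow> ginv G g \<in> H"
  unfolding subgroupoid_def by blast

lemma gen_restriction_subset: "gen (K \<inter> restriction G U) \<subseteq> restriction G U"
  by (rule gen_minimal) (auto simp: subgroupoid_restriction)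

text \<open>The scales at which coarse geometry is done: every relatively compact set can be enlarged to
  such a set, and then being joined by an arrow of the set is a reflexive and symmetric relation.\<close>

definition symmetric_unital :: "'a set \<Rightarrow> bool" where
  "symmetric_unital K \<longleftrightarrow> K \<subseteq> arrows G \<and> units G \<subseteq> K \<and> ginv G ` K \<subseteq> K"

text \<open>For a symmetric generating set, an arrow of the generated subgroupoid is a path of generators,
  and paths can be built by prepending one generator at a time. The arrows that preserve \<open>S\<close> under
  left multiplication, together with their inverses, form a subgroupoid.\<close>

lemma gen_subsetI:
  assumes L: "L \<subseteq> arrows G" "\<And>k. k \<in> L \<Longrightarrow> ginv G k \<in> L" 
    and S: "S \<subseteq> arrows G"
    and unit: "\<And>k. k \<in> L \<Longrightarrow> src G k \<in> S"
    and step: "\<And>k g. \<lbrakk>k \<in> L; g \<in> S; src G k = rng G g\<rbrakk> \<Longrightarrow> k \<cdot> g \<in> S"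
  shows "gen L \<subseteq> S"
proof -
  define T where "T = {g \<in> arrows G. src G g \<in> S \<and> rng G g \<in> S \<and>
      (\<forall>h\<in>S. src G g = rng G h \<longrightarrow> g \<cdot> h \<in> S) \<and> (\<forall>h\<in>S. rng G g = rng G h \<longrightarrow> ginv G g \<cdot> h \<in> S)}"
  have "subgroupoid G T"
    unfolding subgroupoid_def
  proof (intro conjI ballI impI)
    show "T \<subseteq> arrows G" by (auto simp: T_def)
    show "ginv G g \<in> T" if "g \<in> T" for g
      using that by (auto simp: T_def)
    show "g \<cdot> h \<in> T" if "g \<in> T" "h \<in> T" "src G g = rng G h" for g h
      using that S by (auto simp: T_def subset_iff gm_assoc inv_gm)
  qed
  moreover have "L \<subseteq> T"
  proof
    fix k assume k: "k \<in> L"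
    then have "ginv G k \<in> L" "k \<in> arrows G" using L by auto
    then show "k \<in> T" using k unit[of k] unit[of "ginv G k"] step
      by (auto simp: T_def)
  qed
  ultimately have "gen L \<subseteq> T" by (intro gen_minimal)
  moreover have "g \<in> S" if "g \<in> T" for g
    using that by (auto simp: T_def dest!: bspec[where x = "src G g"])
  ultimately show ?thesis by blast
qed

end

section \<open>Topology of etale groupoids\<close>

context topological_groupoid
begin

lemma continuous_gm:
  assumes "continuous_map Z (gtop G) f" "continuous_map Z (gtop G) h"
    and "\<And>z. z \<in> topspace Z \<Longrightarrow> src G (f z) = rng G (h z)"
  shows "continuous_map Z (gtop G) (\<lambda>z. f z \<cdot> h z)"
proof -
  have "f z \<in> arrows G" "h z \<in> arrows G" if "z \<in> topspace Z" for z
    using assms(1,2) that by (auto simp: continuous_map_def)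
  then have "continuous_map Z (subtopology (prod_topology (gtop G) (gtop G)) (composable G)) (\<lambda>z. (f z, h z))"
    using assms by (auto simp: continuous_map_in_subtopology continuous_map_pairedI composable_def)
  from continuous_map_compose[OF this continuous_mult] show ?thesis by (simp add: o_def)
qed

lemma continuous_src: "continuous_map (gtop G) (gtop G) (src G)"
proof -
  have "continuous_map (gtop G) (gtop G) (\<lambda>g. ginv G g \<cdot> g)"
    by (rule continuous_gm) (use continuous_inv in auto)
  then show ?thesis by (rule continuous_map_eq) simp
qed

lemma continuous_rng: "continuous_map (gtop G) (gtop G) (rng G)"
proof -
  have "continuous_map (gtop G) (gtop G) (\<lambda>g. g \<cdot> ginv G g)"
    by (rule continuous_gm) (use continuous_inv in auto)
  then show ?thesis by (rule continuous_map_eq) simp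
qed

lemma openin_inv_image:
  assumes "openin (gtop G) A" shows "openin (gtop G) (ginv G ` A)"
proof -
  have "A \<subseteq> arrows G" using assms openin_subset by blast
  then have "ginv G ` A = {g \<in> arrows G. ginv G g \<in> A}"
    by (auto simp: subset_iff) (metis image_eqI inv_inv)
  then show ?thesis 
    using openin_continuous_map_preimage[OF continuous_inv assms] by simp
qed

end

context etale_groupoid
begin

text \<open>The form in which the etale condition is used: near every arrow the source map has a
  continuous inverse.\<close>

lemma src_section:
  assumes "g \<in> arrows G"
  obtains U \<sigma> where "openin (gtop G) U" "g \<in> U" 
    "continuous_map (subtopology (gtop G) (src G ` U)) (gtop G) \<sigma>"
    "\<And>u. u \<in> U \<Longrightarrow> \<sigma> (src G u) = u"
    "homeomorphic_map (subtopology (gtop G) U) (subtopology (gtop G) (src G ` U)) (src G)"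
    "openin (unit_space G) (src G ` U)"
proof -
  obtain U where U: "g \<in> U" "openin (gtop G) U" "openin (unit_space G) (src G ` U)"
    "homeomorphic_map (subtopology (gtop G) U) (subtopology (unit_space G) (src G ` U)) (src G)"
    using local_homeomorphism_src assms unfolding local_homeomorphism_def by blast
  have sub: "subtopology (unit_space G) (src G ` U) = subtopology (gtop G) (src G ` U)"
    using openin_subset[OF U(3)] by (simp add: subtopology_subtopology inf.absorb2)
  obtain \<sigma> where \<sigma>: "homeomorphic_maps (subtopology (gtop G) U) (subtopology (gtop G) (src G ` U)) (src G) \<sigma>"
    using U(4) unfolding sub homeomorphic_map_maps by blast
  show ?thesis
  proof (rule that[OF U(2,1) _ _ _ U(3)])
    show "continuous_map (subtopology (gtop G) (src G ` U)) (gtop G) \<sigma>"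
      using \<sigma> by (simp add: homeomorphic_maps_def continuous_map_in_subtopology)
    show "\<sigma> (src G u) = u" if "u \<in> U" for u
      using \<sigma> that openin_subset[OF U(2)] by (auto simp: homeomorphic_maps_def)
    show "homeomorphic_map (subtopology (gtop G) U) (subtopology (gtop G) (src G ` U)) (src G)"
      using U(4) by (simp add: sub)
  qed
qed

text \<open>Near a unit the source map is injective and has values in the same neighbourhood, so an arrow \<open>g\<close>
  there equals the unit \<open>src g\<close>, which has the same source.\<close>

lemma openin_units: "openin (gtop G) (units G)"
proof (subst openin_subopen, intro ballI)
  fix x assume x: "x \<in> units G"
  obtain U \<sigma> where U: "openin (gtop G) U" "x \<in> U" "\<And>u. u \<in> U \<Longrightarrow> \<sigma> (src G u) = u"
    using src_section[OF units_arrows[OF x]] by metis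
  let ?V = "{g \<in> U. src G g \<in> U}"
  have "openin (gtop G) ?V"
    by (rule openin_continuous_map_preimage_gen[OF continuous_src U(1) U(1)])
  moreover have "x \<in> ?V" using U x by simp
  moreover have "?V \<subseteq> units G"
  proof
    fix g assume g: "g \<in> ?V"
    then have ga: "g \<in> arrows G" using openin_subset[OF U(1)] by auto
    have "g = \<sigma> (src G g)" using g U by simp
    also have "\<dots> = \<sigma> (src G (src G g))" using ga by simp
    also have "\<dots> = src G g" using g U by blast
    finally show "g \<in> units G" using ga src_in_units by metis
  qed
  ultimately show "\<exists>V. openin (gtop G) V \<and> x \<in> V \<and> V \<subseteq> units G" by blast
qed

lemma openin_unit_space: "openin (unit_space G) A \<longleftrightarrow> openin (gtop G) A \<and> A \<subseteq> units G"
  by (rule openin_open_subtopology[OF openin_units])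

lemma openin_src_image:
  assumes "openin (gtop G) A" shows "openin (gtop G) (src G ` A)"
proof (subst openin_subopen, clarify)
  fix g assume g: "g \<in> A"
  then obtain U where U: "openin (gtop G) U" "g \<in> U" "openin (unit_space G) (src G ` U)"
    "homeomorphic_map (subtopology (gtop G) U) (subtopology (gtop G) (src G ` U)) (src G)"
    using src_section[of g] openin_subset[OF assms] by (metis subsetD)
  have "openin (subtopology (gtop G) U) (U \<inter> A)"
    using assms by (simp add: openin_subtopology_Int2)
  then have "openin (subtopology (gtop G) (src G ` U)) (src G ` (U \<inter> A))"
    using homeomorphic_imp_open_map[OF U(4)] by (simp add: open_map_def)
  then have "openin (gtop G) (src G ` (U \<inter> A))"
    using U(3) openin_trans_full openin_unit_space by blast
  then show "\<exists>T. openin (gtop G) T \<and> src G g \<in> T \<and> T \<subseteq> src G ` A"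
    using g U(2) by blast
qed

text \<open>The composable pairs form a closed set because the space is Hausdorff.\<close>

lemma compactin_set_mult:
  assumes "compactin (gtop G) A" "compactin (gtop G) B"
  shows "compactin (gtop G) (set_mult G A B)"
proof -
  let ?P = "prod_topology (gtop G) (gtop G)"
  have comp_eq: "composable G = {z \<in> topspace ?P. src G (fst z) = rng G (snd z)}"
    by (auto simp: composable_def)
  have cl: "closedin ?P (composable G)"
    unfolding comp_eq
  proof (rule closedin_continuous_maps_eq[OF Hausdorff])
    show "continuous_map ?P (gtop G) (\<lambda>z. src G (fst z))"
      using continuous_map_compose[OF continuous_map_fst continuous_src] by (simp add: o_def)
    show "continuous_map ?P (gtop G) (\<lambda>z. rng G (snd z))"
      using continuous_map_compose[OF continuous_map_snd continuous_rng] by (simp add: o_def)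
  qed
  have "compactin ?P (A \<times> B)" using assms by (simp add: compactin_Times)
  then have "compactin (subtopology ?P (composable G)) (composable G \<inter> A \<times> B)"
    using closed_Int_compactin[OF cl] by (simp add: compactin_subtopology)
  from image_compactin[OF this continuous_mult] 
  have "compactin (gtop G) ((\<lambda>(g, h). g \<cdot> h) ` (composable G \<inter> A \<times> B))" .
  moreover have "(\<lambda>(g, h). g \<cdot> h) ` (composable G \<inter> A \<times> B) = set_mult G A B"
    using compactin_subset_topspace[OF assms(1)] compactin_subset_topspace[OF assms(2)]
    by (force simp: set_mult_def composable_def)
  ultimately show ?thesis by simp
qed

text \<open>Near \<open>a \<cdot> b\<close> the second factor can be recovered continuously from the source of the product,
  by a local section through \<open>b\<close>; dividing by it shows which nearby arrows are products.\<close>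

lemma openin_set_mult:
  assumes A: "openin (gtop G) A" and B: "openin (gtop G) B"
  shows "openin (gtop G) (set_mult G A B)"
proof (subst openin_subopen, intro ballI)
  fix g assume "g \<in> set_mult G A B"
  then obtain a b where ab: "a \<in> A" "b \<in> B" "src G a = rng G b" "g = a \<cdot> b"
    by (auto simp: set_mult_def)
  have ar: "a \<in> arrows G" "b \<in> arrows G" using ab openin_subset A B by blast+
  obtain U \<sigma> where U: "openin (gtop G) U" "b \<in> U" 
    "continuous_map (subtopology (gtop G) (src G ` U)) (gtop G) \<sigma>"
    "\<And>u. u \<in> U \<Longrightarrow> \<sigma> (src G u) = u"
    using src_section[OF ar(2)] by metis
  define N where "N = {g \<in> arrows G. src G g \<in> src G ` (U \<inter> B)}"
  have N: "openin (gtop G) N"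
    unfolding N_def 
    by (intro openin_continuous_map_preimage[OF continuous_src] openin_src_image openin_Int U B)
  have \<sigma>: "\<sigma> (src G h) \<in> B \<and> \<sigma> (src G h) \<in> arrows G \<and> src G (\<sigma> (src G h)) = src G h" if "h \<in> N" for h
    using that U openin_subset[OF B] unfolding N_def by auto
  have c1: "continuous_map (subtopology (gtop G) N) (subtopology (gtop G) (src G ` U)) (src G)"
    using continuous_src by (auto simp: continuous_map_in_subtopology continuous_map_from_subtopology N_def)
  define m where "m = (\<lambda>h. h \<cdot> ginv G (\<sigma> (src G h)))"
  have "continuous_map (subtopology (gtop G) N) (gtop G) m"
    unfolding m_def
  proof (rule continuous_gm)
    show "continuous_map (subtopology (gtop G) N) (gtop G) (\<lambda>h. h)"
      by (simp add: continuous_map_from_subtopology)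
    show "continuous_map (subtopology (gtop G) N) (gtop G) (\<lambda>h. ginv G (\<sigma> (src G h)))"
      using continuous_map_compose[OF continuous_map_compose[OF c1 U(3)] continuous_inv]
      by (simp add: o_def)
  qed (use \<sigma> in auto)
  from openin_continuous_map_preimage[OF this A]
  have "openin (gtop G) {h \<in> N. m h \<in> A}"
    using N openin_subset[OF N] by (simp add: openin_open_subtopology Int_absorb1)
  moreover have "g \<in> {h \<in> N. m h \<in> A}"
  proof -
    have "\<sigma> (src G b) = b" using U ab by blast
    then have "m g = a" using ar ab by (simp add: m_def gm_assoc) (metis mult_src)
    then show ?thesis using ab ar U by (auto simp: N_def)
  qed
  moreover have "{h \<in> N. m h \<in> A} \<subseteq> set_mult G A B"
  proof clarify
    fix h assume h: "h \<in> N" "m h \<in> A"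
    then have "h \<in> arrows G" by (simp add: N_def)
    then have "m h \<cdot> \<sigma> (src G h) = h" "src G (m h) = rng G (\<sigma> (src G h))"
      using \<sigma>[OF h(1)] by (simp_all add: m_def gm_assoc)
    then show "h \<in> set_mult G A B"
      using h \<sigma>[OF h(1)] unfolding set_mult_def mem_Collect_eq by metis
  qed
  ultimately show "\<exists>T. openin (gtop G) T \<and> g \<in> T \<and> T \<subseteq> set_mult G A B" by blast
qed

lemma relatively_compact_in_open:
  assumes "compactin (gtop G) C"
  obtains W where "openin (gtop G) W" "relatively_compactin (gtop G) W" "C \<subseteq> W"
proof -
  obtain U L where "openin (gtop G) U" "compactin (gtop G) L" "closedin (gtop G) L" "C \<subseteq> U" "U \<subseteq> L"
    using locally_compact assms Hausdorff locally_compact_space_compact_closed_compact by metis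
  moreover from this have "relatively_compactin (gtop G) U"
    unfolding relatively_compactin_def
    by (meson closed_compactin closedin_closure_of closure_of_minimal openin_subset)
  ultimately show ?thesis using that by blast
qed

lemma relatively_compact_subset:
  "\<lbrakk>relatively_compactin (gtop G) T; S \<subseteq> T\<rbrakk> \<Longrightarrow> relatively_compactin (gtop G) S"
  unfolding relatively_compactin_def 
  by (meson closed_compactin closedin_closure_of closure_of_mono order_trans)

lemma compact_imp_relatively_compact:
  "compactin (gtop G) C \<Longrightarrow> relatively_compactin (gtop G) C"
  unfolding relatively_compactin_def
  by (simp add: Hausdorff closure_of_closedin compactin_imp_closedin compactin_subset_topspace)

lemma relatively_compact_Un:
  "\<lbrakk>relatively_compactin (gtop G) S; relatively_compactin (gtop G) T\<rbrakk> 
    \<Longrightarrow> relatively_compactin (gtop G) (S \<union> T)"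
  unfolding relatively_compactin_def by (simp add: compactin_Un)

lemma relatively_compact_imp_closure:
  "relatively_compactin (gtop G) S \<Longrightarrow> S \<subseteq> gtop G closure_of S"
  by (simp add: closure_of_subset relatively_compactin_def)

end

section \<open>Asymptotic dimension is at most dynamic asymptotic dimension\<close>

context groupoid
begin

lemma subgroupoid_div_sym:
  assumes "subgroupoid G H" "g \<in> arrows G" "h \<in> arrows G" "rng G g = rng G h" "ginv G g \<cdot> h \<in> H"
  shows "ginv G h \<cdot> g \<in> H"
  using subgroupoid_inv[OF assms(1,5)] assms(2-4) by (simp add: inv_gm)

lemma subgroupoid_div_trans:
  assumes "subgroupoid G H" "g \<in> arrows G" "h \<in> arrows G" "k \<in> arrows G" 
    "rng G g = rng G h" "rng G h = rng G k" "ginv G g \<cdot> h \<in> H" "ginv G h \<cdot> k \<in> H"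
  shows "ginv G g \<cdot> k \<in> H"
  using subgroupoid_gm[OF assms(1,7,8)] assms(2-6) by (simp add: gm_assoc)

end

context etale_groupoid
begin

text \<open>The pieces of colour \<open>i\<close> are the cosets \<open>Z i g = g \<cdot> H i\<close>, with \<open>H i\<close> the subgroupoid generated over
  \<open>U i\<close> and \<open>g\<close> an arrow with source in \<open>U i\<close>. The units are added to \<open>K\<close> so that
  the sets \<open>U i\<close> cover the whole unit space and every such arrow lies in its own coset.\<close>

theorem asdim_at_most_if_dad_at_most:
  assumes compact: "compact_space (unit_space G)" and dad: "dad_at_most G d"
  shows "asdim_at_most (arrows G) (canonical_coarse_structure G) d"
  unfolding asdim_at_most_def
proof
  fix E assume "E \<in> canonical_coarse_structure G"
  then obtain K where K: "openin (gtop G) K" "relatively_compactin (gtop G) K"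
    and E1: "E \<subseteq> {(g, h). g \<in> arrows G \<and> h \<in> arrows G \<and> rng G g = rng G h \<and> ginv G g \<cdot> h \<in> K}
                 \<union> Id_on (arrows G)"
    unfolding canonical_coarse_structure_def by blast
  have units_rc: "relatively_compactin (gtop G) (units G)"
    using compact openin_units by (intro compact_imp_relatively_compact) (simp add: compactin_subspace openin_subset)
  define L where "L = K \<union> units G"
  have L: "openin (gtop G) L" "relatively_compactin (gtop G) L"
    using K openin_units units_rc by (auto simp: L_def relatively_compact_Un)
  then obtain U where U: "src G ` L \<union> rng G ` L \<subseteq> (\<Union>i\<le>d. U i)"
     "\<And>i. i \<le> d \<Longrightarrow> relatively_compactin (gtop G) (gen (L \<inter> restriction G (U i)))"
    using dad unfolding dad_at_most_def by metis
  define H where "H i = gen (L \<inter> restriction G (U i))" for i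
  have H: "subgroupoid G (H i)" for i
    unfolding H_def using restriction_subset_arrows by (intro subgroupoid_gen) blast
  have unit_H: "u \<in> H i" if "u \<in> units G" "u \<in> U i" for u i
  proof -
    have "u \<in> L \<inter> restriction G (U i)" using that units_arrows by (auto simp: restriction_def L_def)
    then show ?thesis unfolding H_def using subset_gen by blast
  qed
  have "compactin (gtop G) (\<Union>i\<le>d. gtop G closure_of H i)"
    using U(2) by (intro compactin_Union) (auto simp: relatively_compactin_def H_def)
  then obtain W where W: "openin (gtop G) W" "relatively_compactin (gtop G) W" "(\<Union>i\<le>d. gtop G closure_of H i) \<subseteq> W"
    using relatively_compact_in_open by metis
  have HW: "H i \<subseteq> W" if "i \<le> d" for i
    using W(3) that relatively_compact_imp_closure[OF U(2)[OF that]] unfolding H_def by blast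
  define F where "F = {(g, h). g \<in> arrows G \<and> h \<in> arrows G \<and> rng G g = rng G h \<and> ginv G g \<cdot> h \<in> W}"
  have F: "F \<in> canonical_coarse_structure G"
    using W unfolding canonical_coarse_structure_def F_def by blast
  define Z where "Z i g = {h \<in> arrows G. rng G g = rng G h \<and> ginv G g \<cdot> h \<in> H i}" for i g
  define \<D> where "\<D> i = Z i ` {g \<in> arrows G. src G g \<in> U i}" for i
  have Z_eq: "Z i g = Z i h" if "g \<in> arrows G" "h \<in> Z i g" for i g h
  proof -
    have gh: "h \<in> arrows G" "rng G g = rng G h" "ginv G g \<cdot> h \<in> H i" "ginv G h \<cdot> g \<in> H i"
      using that subgroupoid_div_sym[OF H, of g h] by (simp_all add: Z_def)
    show ?thesis
      using subgroupoid_div_trans[OF H, of g h] subgroupoid_div_trans[OF H, of h g] gh that(1)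
      unfolding Z_def by (intro Collect_cong) metis
  qed
  have sep: "separated_family E (\<D> i)" if "i \<le> d" for i
    unfolding separated_family_def
  proof (intro ballI impI, rule ccontr)
    fix A B assume AB: "A \<in> \<D> i" "B \<in> \<D> i" "A \<noteq> B" "A \<times> B \<inter> E \<noteq> {}"
    then obtain a b where ab: "a \<in> arrows G" "src G a \<in> U i" "A = Z i a" 
      "b \<in> arrows G" "src G b \<in> U i" "B = Z i b"
      by (auto simp: \<D>_def)
    obtain g h where gh: "g \<in> A" "h \<in> B" "(g, h) \<in> E" using AB by auto
    have ar: "g \<in> arrows G" "h \<in> arrows G" using gh ab by (auto simp: Z_def)
    have in_U: "src G g \<in> U i" if "g \<in> Z i a" "a \<in> arrows G" for a g
    proof -
      have "ginv G a \<cdot> g \<in> restriction G (U i)"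
        using that gen_restriction_subset[of L "U i"] by (auto simp: Z_def H_def)
      then show ?thesis using that by (simp add: restriction_def Z_def)
    qed
    have gU: "src G g \<in> U i" "src G h \<in> U i" using in_U gh ab by auto
    have "rng G g = rng G h \<and> ginv G g \<cdot> h \<in> H i"
    proof (cases "g = h")
      case True
      then show ?thesis using unit_H[of "src G g" i] gU ar by simp
    next
      case False
      then have "rng G g = rng G h" "ginv G g \<cdot> h \<in> L \<inter> restriction G (U i)"
        using gh E1 gU ar by (auto simp: restriction_def L_def)
      then show ?thesis unfolding H_def using subset_gen by blast
    qed
    then have "h \<in> Z i g" using ar by (simp add: Z_def)
    then have "Z i g = Z i h" using Z_eq ar by blast
    then show False using Z_eq gh ab AB by metis
  qed
  have bdd: "A \<times> A \<subseteq> F" if A: "A \<in> \<D> i" "i \<le> d" for i A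
  proof clarify
    fix g h assume gh: "g \<in> A" "h \<in> A"
    from A obtain a where a: "a \<in> arrows G" "A = Z i a" by (auto simp: \<D>_def)
    have "h \<in> Z i g" using gh a Z_eq by metis
    then show "(g, h) \<in> F" using gh HW[OF A(2)] a by (auto simp: F_def Z_def)
  qed
  have cover: "\<Union> (\<Union>i\<le>d. \<D> i) = arrows G"
  proof
    show "\<Union> (\<Union>i\<le>d. \<D> i) \<subseteq> arrows G" by (auto simp: \<D>_def Z_def)
    show "arrows G \<subseteq> \<Union> (\<Union>i\<le>d. \<D> i)"
    proof
      fix g assume g: "g \<in> arrows G"
      then have "src G g \<in> L" by (simp add: L_def)
      then have "src G (src G g) \<in> src G ` L" by blast
      then have "src G g \<in> src G ` L" using g by simp
      then obtain i where i: "i \<le> d" "src G g \<in> U i" using U(1) by blast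
      have "g \<in> Z i g" using g unit_H[of "src G g" i] i by (simp add: Z_def)
      then show "g \<in> \<Union> (\<Union>i\<le>d. \<D> i)" using i g by (auto simp: \<D>_def)
    qed
  qed
  \<comment> \<open>One set of arrows may be a coset for several colours; it is kept for the first of them only.\<close>
  define \<D>' where "\<D>' = disjointed \<D>"
  have \<D>': "\<D>' i \<subseteq> \<D> i" "disjoint_family_on \<D>' {..d}" "(\<Union>i\<le>d. \<D>' i) = (\<Union>i\<le>d. \<D> i)" for i
    using disjointed_subset[of \<D> i] disjoint_family_on_mono[OF subset_UNIV disjoint_family_disjointed[of \<D>]]
      finite_UN_disjointed_eq[of \<D> "Suc d"]
    by (simp_all add: \<D>'_def atLeast0LessThan lessThan_Suc_atMost)
  show "\<exists>F\<in>canonical_coarse_structure G. \<exists>\<U>. \<Union> \<U> = arrows G \<and> bounded_family F \<U> \<and>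
        (\<exists>\<D>::nat \<Rightarrow> 'a set set. \<U> = (\<Union>i\<le>d. \<D> i) \<and> disjoint_family_on \<D> {..d} \<and> (\<forall>i\<le>d. separated_family E (\<D> i)))"
  proof (intro bexI[OF _ F] exI[of _ "\<Union>i\<le>d. \<D>' i"] exI[of _ \<D>'] conjI allI impI refl \<D>'(2))
    show "\<Union> (\<Union>i\<le>d. \<D>' i) = arrows G" using cover \<D>'(3) by simp
    show "bounded_family F (\<Union>i\<le>d. \<D>' i)"
      unfolding \<D>'(3) bounded_family_def using bdd by auto
    show "separated_family E (\<D>' i)" if "i \<le> d" for i
      using sep[OF that] \<D>'(1)[of i] unfolding separated_family_def by blast
  qed
qed

end

section \<open>Ample groupoids\<close>

text \<open>In a compact Hausdorff space quasi-components are connected components, so here they are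
  points; compactness of the complement of \<open>O'\<close> turns separation of points into
  separation from a closed set.\<close>

lemma clopen_neighbourhood:
  assumes "compact_space X" "Hausdorff_space X" "totally_disconnected_space X"
    and O: "openin X O'" "x \<in> O'"
  obtains V where "openin X V" "closedin X V" "x \<in> V" "V \<subseteq> O'"
proof -
  have x: "x \<in> topspace X" using O openin_subset by blast
  have q: "quasi_component_of X x y \<longleftrightarrow> y = x" for y
  proof -
    have "quasi_component_of X x = connected_component_of X x"
      by (rule quasi_eq_connected_component_of) (use assms(1,2) in simp)
    moreover have "connected_component_of_set X x = {x}"
    proof -
      obtain a where "connected_component_of_set X x \<subseteq> {a}"
        using assms(3) connectedin_connected_component_of[of X x]
        unfolding totally_disconnected_space_def by blast
      moreover have "x \<in> connected_component_of_set X x"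
        using x by (simp add: connected_component_of_refl)
      ultimately show ?thesis by blast
    qed
    ultimately show ?thesis by auto
  qed
  then have "{x} \<in> quasi_components_of X"
    unfolding quasi_components_of_def using x by (auto intro!: image_eqI[of _ _ x])
  moreover have "compactin X (topspace X - O')"
    by (rule closedin_compact_space[OF assms(1) closedin_diff[OF closedin_topspace O(1)]])
  ultimately have "separated_between X {x} (topspace X - O')"
    using separated_between_quasi_component_compact[of "{x}" X] O by (simp add: disjnt_def)
  then obtain U V where "openin X U" "openin X V" "U \<union> V = topspace X" "disjnt U V" "{x} \<subseteq> U" "topspace X - O' \<subseteq> V"
    unfolding separated_between_def by blast
  moreover from this have "U = topspace X - V" by (auto simp: disjnt_iff)
  ultimately show ?thesis using that[of U] by (auto simp: openin_closedin_eq)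
qed

text \<open>Over a compact totally disconnected unit space these sets form a basis. In an etale
  groupoid they are stable under finite unions, intersections, differences, products, inverses, and images
  under source and range.\<close>

definition compact_openin :: "'a topology \<Rightarrow> 'a set \<Rightarrow> bool" where
  "compact_openin X A \<longleftrightarrow> compactin X A \<and> openin X A"

lemma compact_openin_empty: "compact_openin X {}"
  by (simp add: compact_openin_def)

lemma compact_openin_Un: "\<lbrakk>compact_openin X A; compact_openin X B\<rbrakk> \<Longrightarrow> compact_openin X (A \<union> B)"
  by (simp add: compact_openin_def compactin_Un openin_Un)

lemma compact_openin_Union:
  "\<lbrakk>finite \<F>; \<And>A. A \<in> \<F> \<Longrightarrow> compact_openin X A\<rbrakk> \<Longrightarrow> compact_openin X (\<Union>\<F>)"
  by (simp add: compact_openin_def compactin_Union openin_Union)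

lemma compact_openin_Int_open_closed:
  "\<lbrakk>compact_openin X A; openin X B; closedin X B\<rbrakk> \<Longrightarrow> compact_openin X (A \<inter> B)"
  by (simp add: compact_openin_def compact_Int_closedin openin_Int)

lemma compact_openin_clopen:
  "\<lbrakk>Hausdorff_space X; compact_openin X A\<rbrakk> \<Longrightarrow> openin X A \<and> closedin X A"
  by (simp add: compact_openin_def compactin_imp_closedin)

lemma compact_openin_Int:
  "\<lbrakk>Hausdorff_space X; compact_openin X A; compact_openin X B\<rbrakk> \<Longrightarrow> compact_openin X (A \<inter> B)"
  by (meson compact_openin_Int_open_closed compact_openin_clopen)

lemma compact_openin_Diff:
  assumes "Hausdorff_space X" "compact_openin X A" "compact_openin X B"
  shows "compact_openin X (A - B)"
proof -
  have "A - B = A \<inter> (topspace X - B)"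
    using assms(2) compactin_subset_topspace unfolding compact_openin_def by blast
  then show ?thesis
    using compact_openin_Int_open_closed[OF assms(2), of "topspace X - B"] compact_openin_clopen[OF assms(1,3)]
    by (simp add: openin_diff closedin_diff)
qed

text \<open>A point is described by the members of a finite family that contain it. Every
  property of this description cuts out a compact open set, so choices that depend on the
  description alone are locally constant.\<close>

lemma compact_openin_label_set:
  assumes "Hausdorff_space X" "finite \<A>" "\<And>A. A \<in> \<A> \<Longrightarrow> compact_openin X A" "compact_openin X U"
  shows "compact_openin X {y \<in> U. P {A \<in> \<A>. y \<in> A}}"
  using assms(2-4)
proof (induction \<A> arbitrary: P U)
  case empty
  then show ?case by (cases "P {}") (simp_all add: compact_openin_empty)
next
  case (insert B \<A>)
  have 1: "{A \<in> insert B \<A>. y \<in> A} = (if y \<in> B then insert B {A \<in> \<A>. y \<in> A} else {A \<in> \<A>. y \<in> A})" for y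
    by auto
  have "{y \<in> U. P {A \<in> insert B \<A>. y \<in> A}} =
        {y \<in> U \<inter> B. P (insert B {A \<in> \<A>. y \<in> A})} \<union> {y \<in> U - B. P {A \<in> \<A>. y \<in> A}}"
    unfolding 1 by auto
  moreover have "compact_openin X (U \<inter> B)" "compact_openin X (U - B)"
    using insert.prems assms(1) compact_openin_Int compact_openin_Diff by blast+
  ultimately show ?case
    using insert.IH[of "U \<inter> B" "\<lambda>S. P (insert B S)"] insert.IH[of "U - B" P] insert.prems(1)
    by (simp add: compact_openin_Un)
qed

lemma openin_compact_openin_refine:
  assumes "compactin X C" and basis: "\<And>x. x \<in> C \<Longrightarrow> \<exists>B. compact_openin X B \<and> x \<in> B \<and> Q B"
  shows "\<exists>\<F>. finite \<F> \<and> (\<forall>B\<in>\<F>. compact_openin X B \<and> Q B) \<and> C \<subseteq> \<Union>\<F>"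
proof -
  let ?\<U> = "{B. compact_openin X B \<and> Q B}"
  have "C \<subseteq> \<Union>?\<U>" using basis by blast
  then obtain \<F> where "finite \<F>" "\<F> \<subseteq> ?\<U>" "C \<subseteq> \<Union>\<F>"
    using compactinD[OF assms(1), of ?\<U>] by (auto simp: compact_openin_def)
  then show ?thesis by blast
qed

context etale_groupoid
begin

abbreviation co :: "'a set \<Rightarrow> bool" where
  "co \<equiv> compact_openin (gtop G)"

lemma co_subset: "co A \<Longrightarrow> A \<subseteq> arrows G"
  by (simp add: compact_openin_def openin_subset)

lemmas co_Diff = compact_openin_Diff[OF Hausdorff]
lemmas co_label_set = compact_openin_label_set[OF Hausdorff]

lemma co_src_image: "co A \<Longrightarrow> co (src G ` A)"
  using continuous_src image_compactin openin_src_image unfolding compact_openin_def by blast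

lemma co_inv_image: "co A \<Longrightarrow> co (ginv G ` A)"
  using continuous_inv image_compactin openin_inv_image unfolding compact_openin_def by blast

lemma rng_image_eq: "A \<subseteq> arrows G \<Longrightarrow> rng G ` A = src G ` ginv G ` A"
  by (force simp: image_image)

lemma co_rng_image: "co A \<Longrightarrow> co (rng G ` A)"
  by (simp add: rng_image_eq co_subset co_src_image co_inv_image)

lemma co_set_mult: "\<lbrakk>co A; co B\<rbrakk> \<Longrightarrow> co (set_mult G A B)"
  by (simp add: compact_openin_def compactin_set_mult openin_set_mult)

lemma co_preimage:
  assumes "co A" "co V" "continuous_map (gtop G) (gtop G) f"
  shows "co {g \<in> A. f g \<in> V}"
proof -
  have "{g \<in> A. f g \<in> V} = A \<inter> {g \<in> arrows G. f g \<in> V}" using co_subset[OF assms(1)] by blast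
  then show ?thesis
    using compact_openin_Int_open_closed[OF assms(1)] compact_openin_clopen[OF Hausdorff assms(2)] 
      openin_continuous_map_preimage[OF assms(3)] closedin_continuous_map_preimage[OF assms(3)] by simp
qed

lemma co_restriction:
  assumes "co A" "co V" shows "co (A \<inter> restriction G V)"
proof -
  have "A \<inter> restriction G V = {g \<in> {g \<in> A. src G g \<in> V}. rng G g \<in> V}"
    using co_subset[OF assms(1)] by (auto simp: restriction_def)
  then show ?thesis
    by (simp only:) (intro co_preimage assms continuous_src continuous_rng)
qed

text \<open>Finitely many open sets on which the source map is injective cover a compact set,
  and each of them meets a fibre at most once.\<close>

lemma bounded_src_fibres:
  assumes "compactin (gtop G) C"
  shows "\<exists>M. \<forall>x. finite {g \<in> C. src G g = x} \<and> card {g \<in> C. src G g = x} \<le> M"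
proof -
  let ?\<U> = "{U. openin (gtop G) U \<and> inj_on (src G) U}"
  have "C \<subseteq> \<Union>?\<U>"
  proof
    fix g assume "g \<in> C"
    then have "g \<in> arrows G" using assms compactin_subset_topspace by blast
    then obtain U \<sigma> where "openin (gtop G) U" "g \<in> U" "\<And>u. u \<in> U \<Longrightarrow> \<sigma> (src G u) = u"
      using src_section by metis
    moreover from this have "inj_on (src G) U" by (metis inj_onI)
    ultimately show "g \<in> \<Union>?\<U>" by blast
  qed
  then obtain \<F> where \<F>: "finite \<F>" "\<F> \<subseteq> ?\<U>" "C \<subseteq> \<Union>\<F>"
    using compactinD[OF assms, of ?\<U>] by auto
  have "\<forall>g\<in>C. \<exists>U. U \<in> \<F> \<and> g \<in> U" using \<F>(3) by blast
  then obtain N where N: "\<And>g. g \<in> C \<Longrightarrow> N g \<in> \<F> \<and> g \<in> N g"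
    by metis
  have "inj_on N {g \<in> C. src G g = x}" "N ` {g \<in> C. src G g = x} \<subseteq> \<F>" for x
  proof -
    show "N ` {g \<in> C. src G g = x} \<subseteq> \<F>" using N by auto
    show "inj_on N {g \<in> C. src G g = x}"
    proof (rule inj_onI)
      fix g h assume "g \<in> {g \<in> C. src G g = x}" "h \<in> {g \<in> C. src G g = x}" "N g = N h"
      then have "src G g = src G h" "g \<in> N g" "h \<in> N g" "inj_on (src G) (N g)"
        using N \<F>(2) by auto
      then show "g = h" by (meson inj_onD)
    qed
  qed
  then show ?thesis
    using \<F>(1) by (meson card_inj_on_le inj_on_finite)
qed

text \<open>Products of \<open>n\<close> generators form a compact open set \<open>P n\<close>, so it suffices that the length of the
  products needed is bounded. The sets \<open>P n\<close> increase with \<open>n\<close>. Within a single source fibre,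
  once one step adds nothing, no later step does. Each earlier step
  adds an element, and the closure of the generated subgroupoid bounds how often this can happen.\<close>

lemma co_gen:
  assumes L: "co L" "\<And>g. g \<in> L \<Longrightarrow> ginv G g \<in> L" "src G ` L \<subseteq> L"
    and rc: "relatively_compactin (gtop G) (gen L)"
  shows "co (gen L)"
proof -
  have La: "L \<subseteq> arrows G" using co_subset L(1) by blast
  have H: "subgroupoid G (gen L)" using subgroupoid_gen La by blast
  define P where "P n = ((set_mult G L) ^^ n) (src G ` L)" for n
  have P0: "P 0 = src G ` L" and PS: "P (Suc n) = set_mult G L (P n)" for n
    by (simp_all add: P_def)
  have co_P: "co (P n)" for n
    by (induction n) (simp_all add: P0 PS co_src_image co_set_mult L(1))
  have P_arrows: "P n \<subseteq> arrows G" for n using co_P co_subset by blast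
  have P_gen: "P n \<subseteq> gen L" for n
  proof (induction n)
    case 0
    then show ?case using L(3) subset_gen unfolding P0 by blast
  next
    case (Suc n)
    then show ?case unfolding PS using subset_gen[of L] subgroupoid_gm[OF H] by (auto simp: set_mult_def)
  qed
  have rng_P: "rng G g \<in> L" if gP: "g \<in> P n" for g n
  proof (cases n)
    case 0
    then obtain k where "k \<in> L" "g = src G k" using gP by (auto simp: P0)
    moreover from this have "k \<in> arrows G" "src G k \<in> L" using L(3) La by blast+
    ultimately show ?thesis by simp
  next
    case (Suc m)
    then obtain k h where kh: "k \<in> L" "h \<in> P m" "src G k = rng G h" "g = k \<cdot> h"
      using gP by (auto simp: PS set_mult_def)
    then have "k \<in> arrows G" "h \<in> arrows G" using La P_arrows by auto
    then have "rng G g = src G (ginv G k)" using kh by simp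
    then show ?thesis using L(2,3) kh(1) by auto
  qed
  have P_mono: "P n \<subseteq> P (Suc n)" for n
  proof
    fix g assume g: "g \<in> P n"
    then have "g \<in> arrows G" using P_arrows by blast
    then have "g = rng G g \<cdot> g" "src G (rng G g) = rng G g" by simp_all
    then show "g \<in> P (Suc n)" unfolding PS set_mult_def using rng_P[OF g] g by blast
  qed
  have "compactin (gtop G) (gtop G closure_of gen L)" using rc by (simp add: relatively_compactin_def)
  from bounded_src_fibres[OF this] obtain M where
    M: "finite {g \<in> gtop G closure_of gen L. src G g = x}"
      "card {g \<in> gtop G closure_of gen L. src G g = x} \<le> M" for x
    by blast
  define S where "S x n = {g \<in> P n. src G g = x}" for x n
  have S_sub: "S x n \<subseteq> {g \<in> gtop G closure_of gen L. src G g = x}" for x n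
    using P_gen relatively_compact_imp_closure[OF rc] unfolding S_def by blast
  have S_stable: "S x (Suc n) = S x (Suc (Suc n))" if "S x n = S x (Suc n)" for x n
  proof
    show "S x (Suc n) \<subseteq> S x (Suc (Suc n))" using P_mono unfolding S_def by blast
    show "S x (Suc (Suc n)) \<subseteq> S x (Suc n)"
    proof
      fix g assume "g \<in> S x (Suc (Suc n))"
      then obtain k h where kh: "k \<in> L" "h \<in> P (Suc n)" "src G k = rng G h" "g = k \<cdot> h" "src G g = x"
        by (auto simp: S_def PS[of "Suc n"] set_mult_def)
      then have "k \<in> arrows G" "h \<in> arrows G" using La P_arrows by auto
      then have "h \<in> S x (Suc n)" using kh by (simp add: S_def)
      then have "h \<in> P n" using that by (auto simp: S_def)
      then show "g \<in> S x (Suc n)" using kh by (auto simp: S_def PS set_mult_def)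
    qed
  qed
  have S_card: "S x n = S x (Suc n) \<or> n \<le> card (S x n)" for x n
  proof (induction n)
    case (Suc n)
    show ?case
    proof (cases "S x n = S x (Suc n)")
      case False
      then have "S x n \<subset> S x (Suc n)" using P_mono[of n] unfolding S_def by blast
      then have "card (S x n) < card (S x (Suc n))"
        by (rule psubset_card_mono[rotated]) (rule finite_subset[OF S_sub M(1)])
      then show ?thesis using Suc False by linarith
    qed (use S_stable in blast)
  qed simp
  have "S x (Suc M) = S x (Suc (Suc M))" for x
    using S_card[of x "Suc M"] card_mono[OF M(1) S_sub, of x "Suc M"] M(2)[of x] by linarith
  then have "g \<in> P (Suc M) \<longleftrightarrow> g \<in> P (Suc (Suc M))" for g
    unfolding S_def by (metis (mono_tags, lifting) mem_Collect_eq)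
  then have stable: "P (Suc M) = P (Suc (Suc M))" by blast
  have P0M: "P 0 \<subseteq> P n" for n
    by (induction n) (use P_mono in auto)
  have "gen L \<subseteq> P (Suc M)"
  proof (rule gen_subsetI[OF La L(2) P_arrows])
    show "src G k \<in> P (Suc M)" if "k \<in> L" for k
      using that P0M unfolding P0 by blast
    show "k \<cdot> g \<in> P (Suc M)" if "k \<in> L" "g \<in> P (Suc M)" "src G k = rng G g" for k g
    proof -
      have "k \<cdot> g \<in> P (Suc (Suc M))" unfolding PS[of "Suc M"] set_mult_def using that by blast
      then show ?thesis using equalityD2[OF stable] by blast
    qed
  qed
  then have "gen L = P (Suc M)" using P_gen[of "Suc M"] by (rule equalityI)
  then show ?thesis using co_P[of "Suc M"] by argo
qed

end

locale ample_groupoid = etale_groupoid +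
  assumes compact_unit_space: "compact_space (unit_space G)"
    and totally_disconnected_unit_space: "totally_disconnected_space (unit_space G)"
begin

lemma co_units: "co (units G)"
  using compact_unit_space openin_units by (simp add: compact_openin_def compactin_subspace openin_subset)

lemma co_basis:
  assumes "openin (gtop G) A" "g \<in> A"
  obtains B where "co B" "g \<in> B" "B \<subseteq> A"
proof -
  have "g \<in> arrows G" using assms openin_subset by blast
  then obtain U \<sigma> where U: "openin (gtop G) U" "g \<in> U" 
    "continuous_map (subtopology (gtop G) (src G ` U)) (gtop G) \<sigma>"
    "\<And>u. u \<in> U \<Longrightarrow> \<sigma> (src G u) = u"
    using src_section by metis
  have "openin (unit_space G) (src G ` (U \<inter> A))"
    unfolding openin_unit_space using openin_src_image[of "U \<inter> A"] U assms openin_subset[OF U(1)] by auto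
  then obtain V where V: "openin (unit_space G) V" "closedin (unit_space G) V" "src G g \<in> V" "V \<subseteq> src G ` (U \<inter> A)"
    using clopen_neighbourhood[OF compact_unit_space Hausdorff_space_subtopology[OF Hausdorff] totally_disconnected_unit_space]
      U(2) assms(2) by (metis IntI imageI)
  have V_co: "compactin (gtop G) V" "openin (gtop G) V"
    using V(1) closedin_compact_space[OF compact_unit_space V(2)]
    by (simp_all add: openin_unit_space compactin_subtopology)
  define B where "B = {h \<in> U \<inter> A. src G h \<in> V}"
  have "openin (gtop G) B"
    unfolding B_def by (intro openin_continuous_map_preimage_gen[OF continuous_src] openin_Int U assms V_co)
  moreover have "B = \<sigma> ` V"
    using U(4) V(4) by (force simp: B_def)
  moreover have "compactin (gtop G) (\<sigma> ` V)"
    by (rule image_compactin[OF _ U(3)]) (use V V_co in \<open>auto simp: compactin_subtopology\<close>)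
  ultimately have "co B" by (simp add: compact_openin_def)
  then show ?thesis using that[of B] U V assms by (auto simp: B_def)
qed

lemma co_between:
  assumes "compactin (gtop G) C" "openin (gtop G) A" "C \<subseteq> A"
  obtains B where "co B" "C \<subseteq> B" "B \<subseteq> A"
proof -
  have "\<exists>B. co B \<and> x \<in> B \<and> B \<subseteq> A" if "x \<in> C" for x
    using co_basis[OF assms(2) subsetD[OF assms(3) that]] by metis
  then have "\<exists>\<F>. finite \<F> \<and> (\<forall>B\<in>\<F>. co B \<and> B \<subseteq> A) \<and> C \<subseteq> \<Union>\<F>"
    by (intro openin_compact_openin_refine[OF assms(1), where Q = "\<lambda>B. B \<subseteq> A"])
  then obtain \<F> where \<F>: "finite \<F>" "\<forall>B\<in>\<F>. co B \<and> B \<subseteq> A" "C \<subseteq> \<Union>\<F>"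
    by (elim exE conjE)
  show ?thesis
  proof (rule that)
    show "co (\<Union>\<F>)" by (rule compact_openin_Union[OF \<F>(1)]) (use \<F>(2) in simp)
    show "\<Union>\<F> \<subseteq> A" using \<F>(2) by (simp add: Sup_le_iff)
  qed (rule \<F>(3))
qed

lemma co_symmetric_hull:
  assumes "relatively_compactin (gtop G) K"
  obtains B where "co B" "symmetric_unital B" "K \<subseteq> B"
proof -
  obtain A where A: "co A" "gtop G closure_of K \<subseteq> A"
    using assms co_between[of "gtop G closure_of K" "arrows G"]
    unfolding relatively_compactin_def by (metis closure_of_subset_topspace openin_topspace)
  let ?B = "A \<union> ginv G ` A \<union> units G"
  have "co ?B" by (intro compact_openin_Un A co_inv_image co_units)
  moreover have "symmetric_unital ?B"
    using co_subset[OF A(1)] co_subset[OF co_inv_image[OF A(1)]] 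
    unfolding symmetric_unital_def by (auto simp: units_arrows subset_iff)
  ultimately show ?thesis using that A(2) relatively_compact_imp_closure[OF assms] by blast
qed

end

section \<open>Colouring the orbits of a compact open subgroupoid\<close>

context ample_groupoid
begin

text \<open>In a principal groupoid an arrow outside the unit space has distinct source and range,
  which a compact open set separates; compactness of \<open>C\<close> makes finitely many such sets enough. For a
  subgroupoid \<open>C\<close> it follows that the labels are injective on its orbits.\<close>

lemma separating_labels:
  assumes principal: "principal_groupoid G" and C: "compactin (gtop G) C"
  shows "\<exists>\<A>. finite \<A> \<and> (\<forall>A\<in>\<A>. co A) \<and>
    (\<forall>g\<in>C. {A \<in> \<A>. src G g \<in> A} = {A \<in> \<A>. rng G g \<in> A} \<longrightarrow> g \<in> units G)"
proof -
  let ?sep = "\<lambda>A. {h \<in> {h \<in> arrows G. src G h \<in> A}. rng G h \<in> arrows G - A}"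
  have units_clopen: "closedin (gtop G) (arrows G - units G)"
    using openin_units by (simp add: closedin_diff)
  have "compactin (gtop G) (C \<inter> (arrows G - units G))"
    by (rule compact_Int_closedin[OF C units_clopen])
  moreover have "openin (gtop G) U" if U: "U \<in> ?sep ` {A. co A}" for U
  proof -
    from U obtain A where A: "co A" "U = ?sep A" by blast
    then have "openin (gtop G) A" "openin (gtop G) (arrows G - A)"
      using compact_openin_clopen[OF Hausdorff A(1)] by (auto simp: openin_diff)
    then show ?thesis unfolding A(2)
      by (intro openin_continuous_map_preimage_gen[OF continuous_rng] 
          openin_continuous_map_preimage[OF continuous_src])
  qed
  moreover have "C \<inter> (arrows G - units G) \<subseteq> \<Union>(?sep ` {A. co A})"
  proof
    fix g assume g: "g \<in> C \<inter> (arrows G - units G)"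
    then have "rng G g \<noteq> src G g" using principal unfolding principal_groupoid_def by blast
    then have src_in: "src G g \<in> arrows G - {rng G g}" using g by simp
    have "openin (gtop G) (arrows G - {rng G g})"
      using g Hausdorff by (intro openin_diff) (auto simp: closedin_Hausdorff_sing_eq)
    from this src_in obtain A where "co A" "src G g \<in> A" "A \<subseteq> arrows G - {rng G g}"
      by (rule co_basis)
    then have "g \<in> ?sep A" using g by auto
    then show "g \<in> \<Union>(?sep ` {A. co A})" using \<open>co A\<close> by blast
  qed
  ultimately have "\<exists>\<F>. finite \<F> \<and> \<F> \<subseteq> ?sep ` {A. co A} \<and> C \<inter> (arrows G - units G) \<subseteq> \<Union>\<F>"
    by (rule compactinD)
  then obtain \<F> where \<F>: "finite \<F>" "\<F> \<subseteq> ?sep ` {A. co A}" "C \<inter> (arrows G - units G) \<subseteq> \<Union>\<F>"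
    by (elim exE conjE)
  then obtain \<A> where \<A>: "finite \<A>" "\<A> \<subseteq> {A. co A}" "\<F> = ?sep ` \<A>"
    by (meson finite_subset_image)
  show ?thesis
  proof (intro exI[of _ \<A>] conjI ballI impI \<A>(1))
    show "co A" if "A \<in> \<A>" for A using \<A>(2) that by blast
    show "g \<in> units G" if g: "g \<in> C" "{A \<in> \<A>. src G g \<in> A} = {A \<in> \<A>. rng G g \<in> A}" for g
    proof (rule ccontr)
      assume "g \<notin> units G"
      then have "g \<in> C \<inter> (arrows G - units G)" using g C compactin_subset_topspace by blast
      then obtain A where "A \<in> \<A>" "g \<in> ?sep A" using \<F>(3) \<A>(3) by blast
      then show False using g(2) by blast
    qed
  qed
qed

text \<open>The bound \<open>F\<close> comes from the given cover of the arrows and is thus the same for all sets \<open>U\<close>.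

  The label of a unit \<open>y\<close> is \<open>p y\<close>, and \<open>\<Phi>\<close> is the finite set of colourings of labels. A colouring is bad at
  \<open>x\<close> if a monochromatic path of \<open>K\<close>-steps in the \<open>H\<close>-orbit of \<open>x\<close> composes to an arrow outside \<open>F\<close>.\<close>

lemma colouring_from_cover:
  fixes d :: nat and \<D> :: "nat \<Rightarrow> 'a set set"
  assumes principal: "principal_groupoid G"
    and K: "co K" "symmetric_unital K" and F: "co F"
    and U: "co U" "U \<subseteq> units G" "relatively_compactin (gtop G) (gen (K \<inter> restriction G U))"
    and cover: "arrows G \<subseteq> \<Union>(\<Union>c\<le>d. \<D> c)"
    and separated: "\<And>c A B g h. \<lbrakk>c \<le> d; A \<in> \<D> c; B \<in> \<D> c; g \<in> A; h \<in> B; g \<in> arrows G; h \<in> arrows G;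
        rng G g = rng G h; ginv G g \<cdot> h \<in> K\<rbrakk> \<Longrightarrow> A = B"
    and bounded: "\<And>c A g h. \<lbrakk>c \<le> d; A \<in> \<D> c; g \<in> A; h \<in> A\<rbrakk> \<Longrightarrow> ginv G g \<cdot> h \<in> F"
  obtains W where "\<And>c. co (W c)" "U \<subseteq> (\<Union>c\<le>d. W c)" "\<And>c. W c \<subseteq> U"
    "\<And>c. c \<le> d \<Longrightarrow> gen (K \<inter> restriction G (W c)) \<subseteq> F"
proof -
  have K_arrows: "K \<subseteq> arrows G" and K_units: "units G \<subseteq> K" and K_inv: "\<And>k. k \<in> K \<Longrightarrow> ginv G k \<in> K"
    using K(2) by (auto simp: symmetric_unital_def)
  have KV: "K \<inter> restriction G V \<subseteq> arrows G" "\<And>k. k \<in> K \<inter> restriction G V \<Longrightarrow> ginv G k \<in> K \<inter> restriction G V" 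
     "src G ` (K \<inter> restriction G V) \<subseteq> K \<inter> restriction G V" for V
  proof -
    show "K \<inter> restriction G V \<subseteq> arrows G" using K_arrows by blast
    show "ginv G k \<in> K \<inter> restriction G V" if "k \<in> K \<inter> restriction G V" for k
      using that K_inv by (auto simp: restriction_def)
    show "src G ` (K \<inter> restriction G V) \<subseteq> K \<inter> restriction G V"
      using K_units by (auto simp: restriction_def subset_iff)
  qed
  define H where "H = gen (K \<inter> restriction G U)"
  have H_co: "co H" 
    unfolding H_def by (rule co_gen[OF co_restriction[OF K(1) U(1)] KV(2,3) U(3)])
  have H: "subgroupoid G H" unfolding H_def by (rule subgroupoid_gen[OF KV(1)])
  have H_arrows: "H \<subseteq> arrows G" using H_co co_subset by blast
  have H_U: "src G g \<in> U" "rng G g \<in> U" if "g \<in> H" for g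
    using that gen_restriction_subset[of K U] by (auto simp: H_def restriction_def)
  have U_H: "u \<in> H" if "u \<in> U" for u
  proof -
    have "u \<in> units G" using that U(2) by blast
    then have "u \<in> K \<inter> restriction G U" using that K_units by (auto simp: restriction_def units_arrows)
    then show ?thesis unfolding H_def using subset_gen by blast
  qed
  have H_compact: "compactin (gtop G) H" using H_co by (simp add: compact_openin_def)
  obtain \<A> where \<A>_fin: "finite \<A>" and \<A>_co: "\<forall>A\<in>\<A>. co A" and \<A>_sep:
    "\<forall>g\<in>H. {A \<in> \<A>. src G g \<in> A} = {A \<in> \<A>. rng G g \<in> A} \<longrightarrow> g \<in> units G"
    using separating_labels[OF principal H_compact] by (elim exE conjE)
  note \<A> = \<A>_fin bspec[OF \<A>_co] mp[OF bspec[OF \<A>_sep]]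
  define p where "p y = {A \<in> \<A>. y \<in> A}" for y
  define \<Phi> where "\<Phi> = (Pow \<A> \<rightarrow>\<^sub>E {..d})"
  have \<Phi>_fin: "finite \<Phi>" unfolding \<Phi>_def using \<A>(1) by (intro finite_PiE) auto
  define V where "V \<phi> c = {y \<in> U. \<phi> (p y) = c}" for \<phi> and c :: nat
  have V_co: "co (V \<phi> c)" for \<phi> c
    unfolding V_def p_def by (rule co_label_set[OF \<A>(1,2) U(1)])
  define Q where "Q \<phi> c = gen (K \<inter> restriction G (V \<phi> c))" for \<phi> c
  have Q_H: "Q \<phi> c \<subseteq> H" for \<phi> c
    unfolding Q_def H_def by (rule gen_mono) (auto simp: restriction_def V_def)
  have Q: "subgroupoid G (Q \<phi> c)" for \<phi> c
    unfolding Q_def by (rule subgroupoid_gen[OF KV(1)])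
  have Q_co: "co (Q \<phi> c)" for \<phi> c
    unfolding Q_def
    using co_gen[OF co_restriction[OF K(1) V_co] KV(2,3) relatively_compact_subset[OF U(3) Q_H[unfolded Q_def H_def]]] .
  define long where "long \<phi> = (\<Union>c\<in>{..d}. Q \<phi> c - F)" for \<phi>
  have long_co: "co (long \<phi>)" for \<phi>
    unfolding long_def by (rule compact_openin_Union) (auto intro: co_Diff Q_co F)
  define bad where "bad \<phi> = src G ` {h \<in> H. rng G h \<in> rng G ` long \<phi>}" for \<phi>
  have bad_co: "co (bad \<phi>)" for \<phi>
    unfolding bad_def by (intro co_src_image co_preimage H_co co_rng_image long_co continuous_rng)
  define good where "good \<phi> = U - bad \<phi>" for \<phi>
  have good_co: "co (good \<phi>)" for \<phi>
    unfolding good_def by (intro co_Diff U bad_co)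
  have bad_invariant: "src G g \<in> bad \<phi>" if g: "g \<in> H" "rng G g \<in> bad \<phi>" for g \<phi>
  proof -
    from g obtain h where h: "h \<in> H" "src G h = rng G g" "rng G h \<in> rng G ` long \<phi>"
      by (auto simp: bad_def)
    moreover have "h \<in> arrows G" "g \<in> arrows G" using h(1) g(1) H_arrows by blast+
    ultimately have "h \<cdot> g \<in> H" "src G (h \<cdot> g) = src G g" "rng G (h \<cdot> g) = rng G h"
      using subgroupoid_gm[OF H h(1) g(1) h(2)] by simp_all
    then show ?thesis unfolding bad_def using h(3) by (metis (mono_tags, lifting) image_eqI mem_Collect_eq)
  qed
  have good_invariant: "src G g \<in> good \<phi> \<longleftrightarrow> rng G g \<in> good \<phi>" if g: "g \<in> H" for g \<phi>
    using bad_invariant[OF g, of \<phi>] bad_invariant[OF subgroupoid_inv[OF H g], of \<phi>] H_U[OF g] g H_arrows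
    by (auto simp: good_def)
  define J where "J y = {\<phi> \<in> \<Phi>. y \<in> good \<phi>}" for y
  have J_invariant: "J (src G g) = J (rng G g)" if "g \<in> H" for g
    using good_invariant[OF that] by (simp add: J_def)
  have J_nonempty: "J x \<noteq> {}" if x: "x \<in> U" for x
  proof -
    obtain col Z where colZ: "\<And>g. g \<in> arrows G \<Longrightarrow> col g \<le> d \<and> Z g \<in> \<D> (col g) \<and> g \<in> Z g"
    proof -
      have "\<forall>g\<in>arrows G. \<exists>c A. c \<le> d \<and> A \<in> \<D> c \<and> g \<in> A" using cover by blast
      then show ?thesis using that by metis
    qed
    \<comment> \<open>The arrows of \<open>H\<close> with range \<open>x\<close> correspond to the points of the orbit of \<open>x\<close>. The given
      cover colours these arrows, hence the points, hence their labels.\<close>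
    define lab where "lab S \<gamma> \<longleftrightarrow> \<gamma> \<in> H \<and> rng G \<gamma> = x \<and> p (src G \<gamma>) = S" for S \<gamma>
    have lab_unique: "\<gamma> = \<gamma>'" if "lab S \<gamma>" "lab S \<gamma>'" for S \<gamma> \<gamma>'
    proof -
      have \<gamma>: "\<gamma> \<in> H" "\<gamma>' \<in> H" "rng G \<gamma> = rng G \<gamma>'" "p (src G \<gamma>) = p (src G \<gamma>')" "\<gamma> \<in> arrows G" "\<gamma>' \<in> arrows G"
        using that H_arrows by (auto simp: lab_def)
      then have "ginv G \<gamma> \<cdot> \<gamma>' \<in> H" by (intro subgroupoid_gm[OF H] subgroupoid_inv[OF H]) auto
      then have "ginv G \<gamma> \<cdot> \<gamma>' \<in> units G" using \<A>(3)[of "ginv G \<gamma> \<cdot> \<gamma>'"] \<gamma> by (simp add: p_def)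
      then have "rng G (ginv G \<gamma> \<cdot> \<gamma>') = ginv G \<gamma> \<cdot> \<gamma>'" by simp
      then have "ginv G \<gamma> \<cdot> \<gamma>' = src G \<gamma>" using \<gamma> by simp
      then have "\<gamma> \<cdot> (ginv G \<gamma> \<cdot> \<gamma>') = \<gamma>" using \<gamma> by simp
      then show ?thesis using \<gamma> by simp
    qed
    define \<phi> where "\<phi> = (\<lambda>S\<in>Pow \<A>. if \<exists>\<gamma>. lab S \<gamma> then col (THE \<gamma>. lab S \<gamma>) else 0)"
    have \<phi>_col: "\<phi> (p (src G \<gamma>)) = col \<gamma>" if "\<gamma> \<in> H" "rng G \<gamma> = x" for \<gamma>
    proof -
      have "lab (p (src G \<gamma>)) \<gamma>" using that by (simp add: lab_def)
      moreover from this have "(THE \<gamma>'. lab (p (src G \<gamma>)) \<gamma>') = \<gamma>" using lab_unique by blast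
      moreover have "p (src G \<gamma>) \<in> Pow \<A>" by (auto simp: p_def)
      ultimately show ?thesis by (auto simp: \<phi>_def)
    qed
    have "\<phi> \<in> \<Phi>"
    proof -
      have "(if \<exists>\<gamma>. lab S \<gamma> then col (THE \<gamma>. lab S \<gamma>) else 0) \<le> d" for S
      proof (cases "\<exists>\<gamma>. lab S \<gamma>")
        case True
        then obtain \<gamma> where "lab S \<gamma>" by blast
        moreover from this have "(THE \<gamma>'. lab S \<gamma>') = \<gamma>" using lab_unique by blast
        ultimately show ?thesis using colZ H_arrows by (auto simp: lab_def)
      qed auto
      then show ?thesis unfolding \<Phi>_def \<phi>_def by auto
    qed
    moreover have "x \<notin> bad \<phi>"
    proof
      assume "x \<in> bad \<phi>"
      then obtain h g c where h: "h \<in> H" "src G h = x" and c: "c \<le> d" and g: "g \<in> Q \<phi> c" "g \<notin> F" "rng G h = rng G g"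
        by (auto simp: bad_def long_def)
      \<comment> \<open>Right multiplication by a monochromatic path does not leave the piece \<open>Z \<gamma>\<close>: by separation
        this holds for a single step from \<open>K\<close>.\<close>
      define S where "S = {g \<in> H. rng G g \<in> V \<phi> c \<and> (\<forall>\<gamma>\<in>H. rng G \<gamma> = x \<longrightarrow> src G \<gamma> = rng G g \<longrightarrow> Z (\<gamma> \<cdot> g) = Z \<gamma>)}"
      have "Q \<phi> c \<subseteq> S"
        unfolding Q_def
      proof (rule gen_subsetI[OF KV(1,2)])
        show "S \<subseteq> arrows G" using H_arrows by (auto simp: S_def)
        show "src G k \<in> S" if "k \<in> K \<inter> restriction G (V \<phi> c)" for k
        proof -
          have "k \<in> arrows G" "src G k \<in> V \<phi> c" "src G k \<in> H" 
            using that U_H by (auto simp: restriction_def V_def)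
          moreover have "\<gamma> \<cdot> src G k = \<gamma>" if "\<gamma> \<in> H" "src G \<gamma> = src G k" for \<gamma>
            using that H_arrows by (metis mult_src subsetD)
          ultimately show ?thesis by (simp add: S_def)
        qed
        show "k \<cdot> g \<in> S" if k: "k \<in> K \<inter> restriction G (V \<phi> c)" and g: "g \<in> S" "src G k = rng G g" for k g
        proof -
          have ka: "k \<in> arrows G" "k \<in> K" "src G k \<in> V \<phi> c" "rng G k \<in> V \<phi> c" using k by (auto simp: restriction_def)
          have kH: "k \<in> H" using k Q_H[of \<phi> c] subset_gen unfolding Q_def by blast
          have gH: "g \<in> H" "g \<in> arrows G" using g H_arrows by (auto simp: S_def)
          have "Z (\<gamma> \<cdot> (k \<cdot> g)) = Z \<gamma>" if \<gamma>: "\<gamma> \<in> H" "rng G \<gamma> = x" "src G \<gamma> = rng G k" for \<gamma>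
          proof -
            have \<gamma>a: "\<gamma> \<in> arrows G" using \<gamma> H_arrows by auto
            have \<gamma>k: "\<gamma> \<cdot> k \<in> H" "rng G (\<gamma> \<cdot> k) = x" "src G (\<gamma> \<cdot> k) = src G k" "\<gamma> \<cdot> k \<in> arrows G"
              using subgroupoid_gm[OF H \<gamma>(1) kH \<gamma>(3)] \<gamma> \<gamma>a ka by auto
            have "Z (\<gamma> \<cdot> (k \<cdot> g)) = Z (\<gamma> \<cdot> k \<cdot> g)" using \<gamma>a \<gamma> ka gH g(2) by (simp add: gm_assoc)
            also have "\<dots> = Z (\<gamma> \<cdot> k)" using g \<gamma>k by (simp add: S_def)
            also have "\<dots> = Z \<gamma>"
            proof -
              have "col \<gamma> = c" "col (\<gamma> \<cdot> k) = c"
                using \<phi>_col[OF \<gamma>(1,2)] \<phi>_col[OF \<gamma>k(1,2)] ka \<gamma> \<gamma>k by (auto simp: V_def)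
              moreover have "ginv G \<gamma> \<cdot> (\<gamma> \<cdot> k) \<in> K" using \<gamma>a ka \<gamma> by simp
              ultimately show ?thesis
                using separated[OF c, of "Z \<gamma>" "Z (\<gamma> \<cdot> k)" \<gamma> "\<gamma> \<cdot> k"] colZ[OF \<gamma>a] colZ[OF \<gamma>k(4)] \<gamma>a \<gamma>k \<gamma>(2) by metis
            qed
            finally show ?thesis .
          qed
          moreover have "k \<cdot> g \<in> H" by (rule subgroupoid_gm[OF H kH gH(1) g(2)])
          ultimately show ?thesis using ka gH g(2) by (simp add: S_def)
        qed
      qed
      then have gS: "g \<in> S" using g by blast
      define \<gamma> where "\<gamma> = ginv G h"
      have ha: "h \<in> arrows G" "g \<in> arrows G" using h gS H_arrows by (auto simp: S_def)
      have \<gamma>: "\<gamma> \<in> H" "rng G \<gamma> = x" "src G \<gamma> = rng G g" "\<gamma> \<in> arrows G"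
        using h g subgroupoid_inv[OF H h(1)] ha by (simp_all add: \<gamma>_def)
      have "Z (\<gamma> \<cdot> g) = Z \<gamma>" using gS \<gamma> by (simp add: S_def)
      moreover have "col \<gamma> = c" using \<phi>_col[OF \<gamma>(1,2)] gS \<gamma>(3) by (simp add: S_def V_def)
      ultimately have "ginv G \<gamma> \<cdot> (\<gamma> \<cdot> g) \<in> F"
        using bounded[OF c, of "Z \<gamma>" \<gamma> "\<gamma> \<cdot> g"] colZ[OF \<gamma>(4)] colZ[of "\<gamma> \<cdot> g"] \<gamma> ha by auto
      then show False using \<gamma> ha g(2) by simp
    qed
    ultimately show ?thesis using x by (auto simp: J_def good_def)
  qed
  \<comment> \<open>The choice depends on \<open>y\<close> only through the set \<open>J y\<close>, which is constant on orbits and locally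
    constant.\<close>
  define f where "f y = (SOME \<phi>. \<phi> \<in> J y)" for y
  have f: "f y \<in> \<Phi>" "y \<in> good (f y)" if "y \<in> U" for y
    using someI_ex[of "\<lambda>\<phi>. \<phi> \<in> J y"] J_nonempty[OF that] by (auto simp: f_def J_def)
  have f_invariant: "f (src G g) = f (rng G g)" if "g \<in> H" for g
    using J_invariant[OF that] by (simp add: f_def)
  define W where "W c = {y \<in> U. f y (p y) = c}" for c
  show ?thesis
  proof (rule that[of W])
    show "co (W c)" for c
    proof -
      have "J y = {\<phi> \<in> \<Phi>. good \<phi> \<in> {A \<in> \<A> \<union> good ` \<Phi>. y \<in> A}}" "p y = {A \<in> \<A> \<union> good ` \<Phi>. y \<in> A} \<inter> \<A>" for y
        by (auto simp: J_def p_def)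
      then have "W c = {y \<in> U. (\<lambda>S. (SOME \<phi>. \<phi> \<in> {\<phi> \<in> \<Phi>. good \<phi> \<in> S}) (S \<inter> \<A>) = c) {A \<in> \<A> \<union> good ` \<Phi>. y \<in> A}}"
        unfolding W_def f_def by presburger
      moreover have "co \<dots>"
        by (rule co_label_set) (use \<A> \<Phi>_fin good_co U in auto)
      ultimately show ?thesis by simp
    qed
    show "W c \<subseteq> U" for c by (auto simp: W_def)
    show "U \<subseteq> (\<Union>c\<le>d. W c)"
    proof
      fix y assume y: "y \<in> U"
      have "p y \<in> Pow \<A>" by (auto simp: p_def)
      then have "f y (p y) \<le> d" using f(1)[OF y] unfolding \<Phi>_def by (auto dest: PiE_mem)
      then show "y \<in> (\<Union>c\<le>d. W c)" using y by (auto simp: W_def)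
    qed
    show "gen (K \<inter> restriction G (W c)) \<subseteq> F" if c: "c \<le> d" for c
    proof -
      define S where "S = {g \<in> H. g \<in> Q (f (rng G g)) c}"
      have K_Q: "k \<in> Q (f (rng G k)) c" "k \<in> H" if "k \<in> K \<inter> restriction G (W c)" for k
      proof -
        have "k \<in> K \<inter> restriction G U" using that by (auto simp: restriction_def W_def)
        then show kH: "k \<in> H" unfolding H_def using subset_gen by blast
        have "k \<in> K \<inter> restriction G (V (f (rng G k)) c)"
          using that f_invariant[OF kH] by (auto simp: restriction_def V_def W_def)
        then show "k \<in> Q (f (rng G k)) c" unfolding Q_def using subset_gen by blast
      qed
      have "gen (K \<inter> restriction G (W c)) \<subseteq> S"
      proof (rule gen_subsetI[OF KV(1,2)])
        show "S \<subseteq> arrows G" using H_arrows by (auto simp: S_def)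
        show "src G k \<in> S" if k: "k \<in> K \<inter> restriction G (W c)" for k
        proof -
          have "src G k \<in> K \<inter> restriction G (W c)" using KV(3) k by blast
          then show ?thesis using K_Q by (simp add: S_def)
        qed
        show "k \<cdot> g \<in> S" if k: "k \<in> K \<inter> restriction G (W c)" and g: "g \<in> S" "src G k = rng G g" for k g
        proof -
          have kH: "k \<in> H" "k \<in> Q (f (rng G k)) c" using K_Q[OF k] by auto
          have gH: "g \<in> H" "g \<in> Q (f (rng G k)) c" using g f_invariant[OF kH(1)] by (auto simp: S_def)
          have "k \<cdot> g \<in> H" "k \<cdot> g \<in> Q (f (rng G k)) c"
            using subgroupoid_gm[OF H kH(1) gH(1) g(2)] subgroupoid_gm[OF Q kH(2) gH(2) g(2)] by auto
          moreover have "rng G (k \<cdot> g) = rng G k"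
            using subsetD[OF H_arrows kH(1)] subsetD[OF H_arrows gH(1)] g(2) by simp
          ultimately show ?thesis by (simp add: S_def)
        qed
      qed
      moreover have "g \<in> F" if g: "g \<in> S" for g
      proof (rule ccontr)
        assume "g \<notin> F"
        moreover have gH: "g \<in> H" "g \<in> Q (f (rng G g)) c" using g by (auto simp: S_def)
        ultimately have "rng G g \<in> rng G ` long (f (rng G g))" using c by (auto simp: long_def)
        moreover have "rng G g \<in> U" using H_U gH by blast
        ultimately have "rng G g \<in> bad (f (rng G g))"
          unfolding bad_def using U_H subsetD[OF H_arrows gH(1)]
          by (intro image_eqI[of _ _ "rng G g"]) simp_all
        then show False using f(2)[OF \<open>rng G g \<in> U\<close>] by (simp add: good_def)
      qed
      ultimately show ?thesis by blast
    qed
  qed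
qed

end

section \<open>Merging colourings at increasing scales\<close>

context groupoid
begin

text \<open>Consider a path of \<open>K\<close>-steps inside \<open>V \<union> W\<close>. Between two consecutive visits to \<open>W\<close> it is a single step,
  or it enters \<open>V\<close>, moves there by an arrow of \<open>B\<close>, and returns; in either case the passage belongs to \<open>K B K\<close>.
  Hence the part from the first to the last visit is a path of \<open>K'\<close>-steps in \<open>W\<close> and lies in \<open>F\<close>. What
  remains at either end is a path in \<open>V\<close>, linked to \<open>W\<close> by one step of \<open>K\<close>.\<close>

lemma gen_glue:
  assumes K: "symmetric_unital K" and B: "symmetric_unital B" and F: "symmetric_unital F"
    and V: "V \<subseteq> units G" "gen (K \<inter> restriction G V) \<subseteq> B"
    and K': "set_mult G K (set_mult G B K) \<subseteq> K'" "K' \<subseteq> arrows G"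
    and W: "W \<subseteq> units G" "gen (K' \<inter> restriction G W) \<subseteq> F"
  shows "gen (K \<inter> restriction G (V \<union> W)) \<subseteq> set_mult G B (set_mult G K (set_mult G F (set_mult G K B)))"
proof -
  have ar: "K \<subseteq> arrows G" "B \<subseteq> arrows G" "F \<subseteq> arrows G"
    and un: "units G \<subseteq> K" "units G \<subseteq> B" "units G \<subseteq> F"
    and K_inv: "\<And>k. k \<in> K \<Longrightarrow> ginv G k \<in> K"
    using K B F by (auto simp: symmetric_unital_def)
  define P where "P = gen (K \<inter> restriction G V)"
  define Q where "Q = gen (K' \<inter> restriction G W)"
  have P: "subgroupoid G P" unfolding P_def by (rule subgroupoid_gen) (use ar in blast)
  have Q: "subgroupoid G Q" unfolding Q_def by (rule subgroupoid_gen) (use K'(2) in blast)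
  have PB: "P \<subseteq> B" and QF: "Q \<subseteq> F" using V(2) W(2) by (simp_all add: P_def Q_def)
  have P_ar: "\<And>g. g \<in> P \<Longrightarrow> g \<in> arrows G" and Q_ar: "\<And>g. g \<in> Q \<Longrightarrow> g \<in> arrows G" 
    and K_ar: "\<And>g. g \<in> K \<Longrightarrow> g \<in> arrows G"
    using PB QF ar by blast+
  have P_V: "rng G g \<in> V" "src G g \<in> V" if "g \<in> P" for g
    using that gen_restriction_subset[of K V] by (auto simp: P_def restriction_def)
  have Q_W: "rng G g \<in> W" "src G g \<in> W" if "g \<in> Q" for g
    using that gen_restriction_subset[of K' W] by (auto simp: Q_def restriction_def)
  have P_K: "k \<in> P" if "k \<in> K" "rng G k \<in> V" "src G k \<in> V" for k
    using that ar subset_gen[of "K \<inter> restriction G V"] by (auto simp: P_def restriction_def)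
  have Q_K': "k \<in> Q" if "k \<in> K'" "rng G k \<in> W" "src G k \<in> W" for k
    using that K'(2) subset_gen[of "K' \<inter> restriction G W"] by (auto simp: Q_def restriction_def)
  have P_unit: "v \<in> P" if "v \<in> V" for v
  proof -
    have "v \<in> units G" using that V(1) by blast
    then show ?thesis using P_K[of v] that un(1) by auto
  qed
  have KBK: "k \<cdot> (b \<cdot> l) \<in> K'" if "k \<in> K" "b \<in> B" "l \<in> K" "src G k = rng G b" "src G b = rng G l" for k b l
  proof -
    have "b \<cdot> l \<in> set_mult G B K" unfolding set_mult_def using that by blast
    moreover have "src G k = rng G (b \<cdot> l)" using that ar by (simp add: subset_iff)
    ultimately show ?thesis using K'(1) that(1) unfolding set_mult_def by blast
  qed
  have K_K': "k \<in> K'" if "k \<in> K" for k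
  proof -
    have u: "src G k \<in> units G" "k \<in> arrows G" using that K_ar by auto
    have "k \<cdot> (src G k \<cdot> src G k) \<in> K'"
      by (rule KBK) (use that u un in auto)
    then show ?thesis using unit_gm_unit[OF u(1)] u(2) by simp
  qed
  have Q_unit: "w \<in> Q" if "w \<in> W" for w
  proof -
    have "w \<in> units G" using that W(1) by blast
    then show ?thesis using Q_K'[OF K_K', of w] that un(1) by auto
  qed
  \<comment> \<open>The arrows in \<open>T\<close> start a path at an arbitrary source and end it in \<open>W\<close>; a \<open>tail\<close> is the portion
    up to the first point in \<open>W\<close>.\<close>
  define tail where "tail = W \<union> {k \<cdot> p | k p. k \<in> K \<and> p \<in> P \<and> src G k = rng G p \<and> rng G k \<in> W}"
  define T where "T = {q \<cdot> t | q t. q \<in> Q \<and> t \<in> tail \<and> src G q = rng G t}"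
  have tail_ar: "t \<in> arrows G" "rng G t \<in> W" if "t \<in> tail" for t
    using that W(1) K_ar P_ar by (auto simp: tail_def units_arrows subset_iff)
  have T_ar: "t \<in> arrows G" "rng G t \<in> W" if "t \<in> T" for t
    using that Q_ar tail_ar Q_W by (auto simp: T_def)
  have QT: "q \<cdot> t \<in> T" if q: "q \<in> Q" "t \<in> T" "src G q = rng G t" for q t
  proof -
    obtain q' t' where t: "q' \<in> Q" "t' \<in> tail" "src G q' = rng G t'" "t = q' \<cdot> t'" using q by (auto simp: T_def)
    have eq: "src G q = rng G q'" using t q(3) Q_ar tail_ar by simp
    have "q \<cdot> t = (q \<cdot> q') \<cdot> t'" using t(3) eq Q_ar[OF q(1)] Q_ar[OF t(1)] tail_ar[OF t(2)] by (simp add: t(4) gm_assoc)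
    moreover have "q \<cdot> q' \<in> Q" by (rule subgroupoid_gm[OF Q q(1) t(1) eq])
    moreover have "src G (q \<cdot> q') = rng G t'" using t(3) eq Q_ar[OF q(1)] Q_ar[OF t(1)] by simp
    ultimately show ?thesis using t(2) unfolding T_def by blast
  qed
  have tail_T: "t \<in> T" if "t \<in> tail" for t
  proof -
    have "rng G t \<in> Q" "rng G t \<cdot> t = t" "src G (rng G t) = rng G t" 
      using tail_ar[OF that] Q_unit by auto
    then show ?thesis unfolding T_def using that by (metis (mono_tags, lifting) mem_Collect_eq)
  qed
  define S where "S = P \<union> T \<union> {p \<cdot> (k \<cdot> t) | p k t. p \<in> P \<and> k \<in> K \<and> t \<in> T \<and> src G p = rng G k \<and> src G k = rng G t}"
  have head_S: "p \<cdot> (k \<cdot> t) \<in> S" if "p \<in> P" "k \<in> K" "t \<in> T" "src G p = rng G k" "src G k = rng G t" for p k t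
    unfolding S_def using that by blast
  have "gen (K \<inter> restriction G (V \<union> W)) \<subseteq> S"
  proof (rule gen_subsetI)
    show "K \<inter> restriction G (V \<union> W) \<subseteq> arrows G" using ar by blast
    show "ginv G k \<in> K \<inter> restriction G (V \<union> W)" if "k \<in> K \<inter> restriction G (V \<union> W)" for k
      using that K_inv by (auto simp: restriction_def)
    show "S \<subseteq> arrows G"
      using P_ar T_ar K_ar by (auto simp: S_def)
    show "src G k \<in> S" if "k \<in> K \<inter> restriction G (V \<union> W)" for k
    proof -
      have "src G k \<in> V \<or> src G k \<in> W" using that by (auto simp: restriction_def)
      moreover have "src G k \<in> tail" if "src G k \<in> W" using that by (simp add: tail_def)
      ultimately show ?thesis using P_unit tail_T by (auto simp: S_def)
    qed
    show "l \<cdot> g \<in> S" if l: "l \<in> K \<inter> restriction G (V \<union> W)" and g: "g \<in> S" "src G l = rng G g" for l g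
    proof -
      have lK: "l \<in> K" "l \<in> arrows G" and l_rng: "rng G l \<in> V \<or> rng G l \<in> W"
        using l by (auto simp: restriction_def)
      consider (P) "g \<in> P" | (T) "g \<in> T" 
        | (head) p k t where "p \<in> P" "k \<in> K" "t \<in> T" "src G p = rng G k" "src G k = rng G t" "g = p \<cdot> (k \<cdot> t)"
        using g(1) unfolding S_def by blast
      then show ?thesis
      proof cases
        case P
        show ?thesis
        proof (cases "rng G l \<in> V")
          case True
          then have "l \<in> P" using P_K lK g(2) P_V[OF P] by simp
          then have "l \<cdot> g \<in> P" using subgroupoid_gm[OF \<open>subgroupoid G P\<close> _ P g(2)] by blast
          then show ?thesis by (simp add: S_def)
        next
          case False
          then have "l \<cdot> g \<in> tail" unfolding tail_def using l_rng lK P g(2) by blast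
          then show ?thesis using tail_T by (simp add: S_def)
        qed
      next
        case T
        show ?thesis
        proof (cases "rng G l \<in> V")
          case True
          have "rng G l \<cdot> (l \<cdot> g) \<in> S"
            by (rule head_S[OF P_unit[OF True] lK(1) T]) (use lK g in simp_all)
          moreover have "rng G l \<cdot> (l \<cdot> g) = l \<cdot> g"
            using rng_mult_left[of "l \<cdot> g"] lK T_ar[OF T] g(2) by simp
          ultimately show ?thesis by simp
        next
          case False
          then have "l \<in> Q" using Q_K' K_K' lK l_rng T_ar[OF T] g(2) by simp
          then show ?thesis using QT[OF _ T g(2)] by (simp add: S_def)
        qed
      next
        case head
        have ars: "p \<in> arrows G" "k \<in> arrows G" "t \<in> arrows G" using head P_ar K_ar T_ar by auto
        then have lp: "src G l = rng G p" using head g(2) by simp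
        show ?thesis
        proof (cases "rng G l \<in> V")
          case True
          then have "l \<in> P" using P_K lK lp P_V head by simp
          then have lpP: "l \<cdot> p \<in> P" using subgroupoid_gm[OF P _ head(1) lp] by blast
          have "(l \<cdot> p) \<cdot> (k \<cdot> t) \<in> S"
            by (rule head_S[OF lpP head(2,3)]) (use lK lp ars head in simp_all)
          then show ?thesis using head lK lp ars by (simp add: gm_assoc)
        next
          case False
          then have rW: "rng G l \<in> W" using l_rng by blast
          have "l \<cdot> (p \<cdot> k) \<in> K'"
            using KBK[OF lK(1) _ head(2) lp head(4)] head(1) PB by blast
          moreover have "rng G (l \<cdot> (p \<cdot> k)) = rng G l" "src G (l \<cdot> (p \<cdot> k)) = rng G t"
            using lK lp ars head by simp_all
          ultimately have "l \<cdot> (p \<cdot> k) \<in> Q" using Q_K' rW T_ar[OF head(3)] by simp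
          from QT[OF this head(3)] have "l \<cdot> (p \<cdot> k) \<cdot> t \<in> T" using lK lp ars head by simp
          then show ?thesis using head lK lp ars by (simp add: S_def gm_assoc)
        qed
      qed
    qed
  qed
  moreover have "S \<subseteq> set_mult G B (set_mult G K (set_mult G F (set_mult G K B)))" (is "_ \<subseteq> set_mult G B ?KFKB")
  proof -
    have left: "g \<in> set_mult G A C" if "units G \<subseteq> A" "g \<in> C" "g \<in> arrows G" for g A C
      using that rng_in_units[of g] unfolding set_mult_def 
      by (intro CollectI exI[of _ "rng G g"] exI[of _ g]) auto
    have mult: "a \<cdot> b \<in> set_mult G A C" if "a \<in> A" "b \<in> C" "src G a = rng G b" for a b A C
      using that unfolding set_mult_def by blast
    have tail_sub: "t \<in> set_mult G K B" if t: "t \<in> tail" for t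
      using t unfolding tail_def
    proof
      assume "t \<in> W"
      then show ?thesis using left[OF un(1), of t B] un(2) W(1) units_arrows by blast
    next
      assume "t \<in> {k \<cdot> p | k p. k \<in> K \<and> p \<in> P \<and> src G k = rng G p \<and> rng G k \<in> W}"
      then show ?thesis using mult PB by blast
    qed
    have T_sub: "t \<in> set_mult G F (set_mult G K B)" if "t \<in> T" for t
      using that tail_sub QF mult unfolding T_def by blast
    have P_sub: "p \<in> set_mult G B ?KFKB" if p: "p \<in> P" for p
    proof -
      have "p \<in> B" "p \<in> arrows G" using p PB P_ar by auto
      then show ?thesis using left un by metis
    qed
    have KT: "k \<cdot> t \<in> ?KFKB" if "k \<in> K" "t \<in> T" "src G k = rng G t" for k t
      using mult[OF that(1) T_sub[OF that(2)] that(3)] .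
    show ?thesis
    proof
      fix g assume "g \<in> S"
      then consider "g \<in> P" | "g \<in> T" 
        | p k t where "p \<in> P" "k \<in> K" "t \<in> T" "src G p = rng G k" "src G k = rng G t" "g = p \<cdot> (k \<cdot> t)"
        unfolding S_def by blast
      then show "g \<in> set_mult G B ?KFKB"
      proof cases
        case 1
        then show ?thesis by (rule P_sub)
      next
        case 2
        then have "g \<in> ?KFKB" using left[OF un(1) T_sub[OF 2]] T_ar by blast
        then show ?thesis using left[OF un(2)] T_ar[OF 2] by blast
      next
        case 3
        have "src G p = rng G (k \<cdot> t)" using 3 K_ar T_ar by simp
        then show ?thesis using mult[of p B "k \<cdot> t" ?KFKB] KT[OF 3(2,3,5)] 3 PB by blast
      qed
    qed
  qed
  ultimately show ?thesis by blast
qed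

end

section \<open>Dynamic asymptotic dimension is at most asymptotic dimension\<close>

context ample_groupoid
begin

lemma co_relatively_compact: "co A \<Longrightarrow> relatively_compactin (gtop G) A"
  by (simp add: compact_openin_def compact_imp_relatively_compact)

text \<open>The asymptotic dimension is applied to the controlled set given by \<open>K\<close>, before \<open>U\<close> is chosen.\<close>

lemma uniform_colouring:
  assumes principal: "principal_groupoid G"
    and asdim: "asdim_at_most (arrows G) (canonical_coarse_structure G) d"
    and K: "co K" "symmetric_unital K"
  shows "\<exists>F. co F \<and> symmetric_unital F \<and>
    (\<forall>U. co U \<and> U \<subseteq> units G \<and> relatively_compactin (gtop G) (gen (K \<inter> restriction G U)) \<longrightarrow>
      (\<exists>W. (\<forall>c\<le>d. co (W c) \<and> W c \<subseteq> units G \<and> gen (K \<inter> restriction G (W c)) \<subseteq> F) \<and> U \<subseteq> (\<Union>c\<le>d. W c)))"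
proof -
  define E where "E = {(g, h). g \<in> arrows G \<and> h \<in> arrows G \<and> rng G g = rng G h \<and> ginv G g \<cdot> h \<in> K}"
  have "E \<in> canonical_coarse_structure G"
    using K(1) co_relatively_compact[OF K(1)] unfolding canonical_coarse_structure_def E_def compact_openin_def by blast
  then obtain F0 \<U> \<D> where F0: "F0 \<in> canonical_coarse_structure G" and \<U>: "\<Union>\<U> = arrows G" "bounded_family F0 \<U>"
    and \<D>: "\<U> = (\<Union>i\<le>d. \<D> i)" "\<forall>i\<le>d. separated_family E (\<D> i)"
    using asdim unfolding asdim_at_most_def by metis
  from F0 obtain A where A: "relatively_compactin (gtop G) A" and
    F0A: "F0 \<subseteq> {(g, h). g \<in> arrows G \<and> h \<in> arrows G \<and> rng G g = rng G h \<and> ginv G g \<cdot> h \<in> A} \<union> Id_on (arrows G)"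
    unfolding canonical_coarse_structure_def by blast
  obtain F where F: "co F" "symmetric_unital F" "A \<subseteq> F"
    by (rule co_symmetric_hull[OF A])
  have "\<exists>W. (\<forall>c\<le>d. co (W c) \<and> W c \<subseteq> units G \<and> gen (K \<inter> restriction G (W c)) \<subseteq> F) \<and> U \<subseteq> (\<Union>c\<le>d. W c)"
    if U: "co U" "U \<subseteq> units G" "relatively_compactin (gtop G) (gen (K \<inter> restriction G U))" for U
  proof -
    have cov: "arrows G \<subseteq> \<Union>(\<Union>c\<le>d. \<D> c)" using \<U>(1) \<D>(1) by simp
    have sep: "A' = B'" if "c \<le> d" "A' \<in> \<D> c" "B' \<in> \<D> c" "g \<in> A'" "h \<in> B'" "g \<in> arrows G" "h \<in> arrows G"
        "rng G g = rng G h" "ginv G g \<cdot> h \<in> K" for c A' B' g h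
    proof (rule ccontr)
      assume "A' \<noteq> B'"
      then have "A' \<times> B' \<inter> E = {}" using \<D>(2) that(1-3) unfolding separated_family_def by blast
      moreover have "(g, h) \<in> A' \<times> B' \<inter> E" using that by (simp add: E_def)
      ultimately show False by blast
    qed
    have bdd: "ginv G g \<cdot> h \<in> F" if "c \<le> d" "A' \<in> \<D> c" "g \<in> A'" "h \<in> A'" for c A' g h
    proof -
      have "A' \<in> \<U>" using that \<D>(1) by blast
      then have "(g, h) \<in> F0" using that \<U>(2) unfolding bounded_family_def by blast
      then consider "ginv G g \<cdot> h \<in> A" | "g \<in> arrows G" "g = h" using F0A by blast
      then show ?thesis
      proof cases
        case 2
        then have "ginv G g \<cdot> h \<in> units G" by simp
        then show ?thesis using F(2) unfolding symmetric_unital_def by blast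
      qed (use F(3) in blast)
    qed
    show ?thesis
    proof (rule colouring_from_cover[OF principal K F(1) U cov sep bdd])
      fix W :: "nat \<Rightarrow> 'a set"
      assume "\<And>c. co (W c)" "U \<subseteq> (\<Union>c\<le>d. W c)" "\<And>c. W c \<subseteq> U"
        "\<And>c. c \<le> d \<Longrightarrow> gen (K \<inter> restriction G (W c)) \<subseteq> F"
      then show ?thesis using U(2) by (intro exI[of _ W]) blast
    qed
  qed
  then show ?thesis using F by blast
qed

text \<open>The scale \<open>R\<close> and the bound \<open>B\<close> are fixed before the sets \<open>U i\<close> are known, so that these
  may be produced by the dynamic asymptotic dimension at scale \<open>R\<close>. In the induction, the scale for
  the next set has to swallow the pieces obtained so far.\<close>

lemma uniform_colouring_finite_union:
  fixes n :: nat
  assumes principal: "principal_groupoid G"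
    and asdim: "asdim_at_most (arrows G) (canonical_coarse_structure G) d"
    and K: "co K" "symmetric_unital K"
  shows "\<exists>R B. co R \<and> symmetric_unital R \<and> co B \<and> symmetric_unital B \<and>
    (\<forall>U. (\<forall>i<n. co (U i) \<and> U i \<subseteq> units G \<and> relatively_compactin (gtop G) (gen (R \<inter> restriction G (U i)))) \<longrightarrow>
      (\<exists>W. (\<forall>c\<le>d. co (W c) \<and> W c \<subseteq> units G \<and> gen (K \<inter> restriction G (W c)) \<subseteq> B) \<and> 
         (\<Union>i<n. U i) \<subseteq> (\<Union>c\<le>d. W c)))"
proof (induction n)
  case 0
  have "gen {} = {}" using gen_minimal[of "{}" "{}"] by (simp add: subgroupoid_def)
  then show ?case
    by (intro exI[of _ K] conjI K allI impI exI[of _ "\<lambda>_. {}"]) 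
       (simp_all add: restriction_def compact_openin_empty)
next
  case (Suc n)
  then obtain R B where R: "co R" "symmetric_unital R" and B: "co B" "symmetric_unital B" 
    and RB: "\<forall>U. (\<forall>i<n. co (U i) \<and> U i \<subseteq> units G \<and> relatively_compactin (gtop G) (gen (R \<inter> restriction G (U i)))) \<longrightarrow>
      (\<exists>W. (\<forall>c\<le>d. co (W c) \<and> W c \<subseteq> units G \<and> gen (K \<inter> restriction G (W c)) \<subseteq> B) \<and> 
         (\<Union>i<n. U i) \<subseteq> (\<Union>c\<le>d. W c))"
    by (elim exE conjE)
  have "co (R \<union> set_mult G K (set_mult G B K))"
    by (intro compact_openin_Un co_set_mult R B K)
  from co_symmetric_hull[OF co_relatively_compact[OF this]]
  obtain K' where K': "co K'" "symmetric_unital K'" "R \<union> set_mult G K (set_mult G B K) \<subseteq> K'" .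
  obtain F where F: "co F" "symmetric_unital F" and FW: 
    "\<forall>U. co U \<and> U \<subseteq> units G \<and> relatively_compactin (gtop G) (gen (K' \<inter> restriction G U)) \<longrightarrow>
      (\<exists>W. (\<forall>c\<le>d. co (W c) \<and> W c \<subseteq> units G \<and> gen (K' \<inter> restriction G (W c)) \<subseteq> F) \<and> U \<subseteq> (\<Union>c\<le>d. W c))"
    using uniform_colouring[OF principal asdim K'(1,2)] by (elim exE conjE)
  have "co (set_mult G B (set_mult G K (set_mult G F (set_mult G K B))))"
    by (intro co_set_mult B K F)
  from co_symmetric_hull[OF co_relatively_compact[OF this]]
  obtain B' where B': "co B'" "symmetric_unital B'" "set_mult G B (set_mult G K (set_mult G F (set_mult G K B))) \<subseteq> B'" .
  show ?case
  proof (rule exI[of _ K'], rule exI[of _ B'], intro conjI allI impI K'(1,2) B'(1,2))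
    fix U :: "nat \<Rightarrow> 'a set"
    assume U: "\<forall>i<Suc n. co (U i) \<and> U i \<subseteq> units G \<and> relatively_compactin (gtop G) (gen (K' \<inter> restriction G (U i)))"
    have "relatively_compactin (gtop G) (gen (R \<inter> restriction G (U i)))" if "i < n" for i
    proof (rule relatively_compact_subset)
      show "relatively_compactin (gtop G) (gen (K' \<inter> restriction G (U i)))" using U that by simp
      show "gen (R \<inter> restriction G (U i)) \<subseteq> gen (K' \<inter> restriction G (U i))"
        by (rule gen_mono) (use K'(3) in blast)
    qed
    then have "\<forall>i<n. co (U i) \<and> U i \<subseteq> units G \<and> relatively_compactin (gtop G) (gen (R \<inter> restriction G (U i)))"
      using U by simp
    from mp[OF spec[OF RB, of U] this] obtain V where V: 
      "\<forall>c\<le>d. co (V c) \<and> V c \<subseteq> units G \<and> gen (K \<inter> restriction G (V c)) \<subseteq> B" "(\<Union>i<n. U i) \<subseteq> (\<Union>c\<le>d. V c)"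
      by (elim exE conjE)
    have "co (U n) \<and> U n \<subseteq> units G \<and> relatively_compactin (gtop G) (gen (K' \<inter> restriction G (U n)))"
      using U by simp
    from mp[OF spec[OF FW, of "U n"] this] obtain W where W: 
      "\<forall>c\<le>d. co (W c) \<and> W c \<subseteq> units G \<and> gen (K' \<inter> restriction G (W c)) \<subseteq> F" "U n \<subseteq> (\<Union>c\<le>d. W c)"
      by (elim exE conjE)
    have glue: "gen (K \<inter> restriction G (V c \<union> W c)) \<subseteq> B'" if "c \<le> d" for c
    proof -
      have "gen (K \<inter> restriction G (V c \<union> W c)) \<subseteq> set_mult G B (set_mult G K (set_mult G F (set_mult G K B)))"
        by (rule gen_glue[OF K(2) B(2) F(2), where K' = K']) 
           (use V(1) W(1) K'(3) co_subset[OF K'(1)] that in auto)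
      then show ?thesis using B'(3) by (rule order_trans)
    qed
    show "\<exists>W. (\<forall>c\<le>d. co (W c) \<and> W c \<subseteq> units G \<and> gen (K \<inter> restriction G (W c)) \<subseteq> B') \<and> 
         (\<Union>i<Suc n. U i) \<subseteq> (\<Union>c\<le>d. W c)"
    proof (intro exI[of _ "\<lambda>c. V c \<union> W c"] conjI allI impI)
      show "co (V c \<union> W c)" if "c \<le> d" for c using V(1) W(1) that by (intro compact_openin_Un) simp_all
      show "V c \<union> W c \<subseteq> units G" if "c \<le> d" for c using V(1) W(1) that by simp
      show "gen (K \<inter> restriction G (V c \<union> W c)) \<subseteq> B'" if "c \<le> d" for c using glue that .
      show "(\<Union>i<Suc n. U i) \<subseteq> (\<Union>c\<le>d. V c \<union> W c)"
        using V(2) W(2) by (auto simp: lessThan_Suc)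
    qed
  qed
qed

text \<open>The bound \<open>N\<close> serves only to fix the number of sets that are merged. The sets it provides are
  shrunk to compact open ones first.\<close>

theorem dad_at_most_if_asdim_at_most:
  assumes principal: "principal_groupoid G"
    and asdim: "asdim_at_most (arrows G) (canonical_coarse_structure G) d"
    and dad: "dad_at_most G N"
  shows "dad_at_most G d"
  unfolding dad_at_most_def
proof (intro allI impI)
  fix K0 assume K0: "openin (gtop G) K0 \<and> relatively_compactin (gtop G) K0"
  then obtain K where K: "co K" "symmetric_unital K" "K0 \<subseteq> K"
    using co_symmetric_hull[of K0] by metis
  obtain R B where R: "co R" "symmetric_unital R" and B: "co B"
    and RB: "\<forall>U. (\<forall>i<Suc N. co (U i) \<and> U i \<subseteq> units G \<and> relatively_compactin (gtop G) (gen (R \<inter> restriction G (U i)))) \<longrightarrow>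
      (\<exists>W. (\<forall>c\<le>d. co (W c) \<and> W c \<subseteq> units G \<and> gen (K \<inter> restriction G (W c)) \<subseteq> B) \<and> 
         (\<Union>i<Suc N. U i) \<subseteq> (\<Union>c\<le>d. W c))"
    using uniform_colouring_finite_union[OF principal asdim K(1,2), of "Suc N"] by (elim exE conjE)
  have "openin (gtop G) R \<and> relatively_compactin (gtop G) R"
    using R(1) co_relatively_compact by (simp add: compact_openin_def)
  from mp[OF spec[OF dad[unfolded dad_at_most_def], of R] this]
  obtain U where U: "\<forall>i\<le>N. openin (unit_space G) (U i)" "src G ` R \<union> rng G ` R \<subseteq> (\<Union>i\<le>N. U i)"
     "\<forall>i\<le>N. relatively_compactin (gtop G) (gen (R \<inter> restriction G (U i)))"
    by (elim exE conjE)
  have U_cover: "units G \<subseteq> (\<Union>i\<le>N. U i)"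
  proof
    fix u assume u: "u \<in> units G"
    then have "u \<in> R" using R(2) unfolding symmetric_unital_def by blast
    then have "src G u \<in> src G ` R" by (rule imageI)
    then show "u \<in> (\<Union>i\<le>N. U i)" using u U(2) by auto
  qed
  have "\<exists>B. co B \<and> u \<in> B \<and> (\<exists>i\<le>N. B \<subseteq> U i)" if u: "u \<in> units G" for u
  proof -
    from u U_cover obtain i where i: "i \<le> N" "u \<in> U i" by blast
    then have "openin (gtop G) (U i)" using U(1) openin_unit_space by blast
    then obtain B where "co B" "u \<in> B" "B \<subseteq> U i" using i(2) by (rule co_basis)
    then show ?thesis using i(1) by blast
  qed
  moreover have "compactin (gtop G) (units G)" using co_units by (simp add: compact_openin_def)
  ultimately have "\<exists>\<F>. finite \<F> \<and> (\<forall>B\<in>\<F>. co B \<and> (\<exists>i\<le>N. B \<subseteq> U i)) \<and> units G \<subseteq> \<Union>\<F>"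
    by (intro openin_compact_openin_refine[where Q = "\<lambda>B. \<exists>i\<le>N. B \<subseteq> U i"])
  then obtain \<F> where \<F>: "finite \<F>" "\<forall>B\<in>\<F>. co B \<and> (\<exists>i\<le>N. B \<subseteq> U i)" "units G \<subseteq> \<Union>\<F>"
    by (elim exE conjE)
  define U' where "U' i = \<Union>{B \<in> \<F>. B \<subseteq> U i}" for i
  have U': "co (U' i)" "U' i \<subseteq> U i" for i
    unfolding U'_def using \<F>(1,2) by (auto intro!: compact_openin_Union)
  have U'_cover: "units G \<subseteq> (\<Union>i<Suc N. U' i)"
    using \<F>(2,3) unfolding U'_def by (fastforce simp: less_Suc_eq_le)
  have "\<forall>i<Suc N. co (U' i) \<and> U' i \<subseteq> units G \<and> relatively_compactin (gtop G) (gen (R \<inter> restriction G (U' i)))"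
  proof (intro allI impI conjI U')
    fix i assume i: "i < Suc N"
    then have "U i \<subseteq> units G" using U(1) openin_unit_space by (simp add: less_Suc_eq_le)
    then show "U' i \<subseteq> units G" using U'(2) by blast
    have "gen (R \<inter> restriction G (U' i)) \<subseteq> gen (R \<inter> restriction G (U i))"
      by (rule gen_mono) (use U'(2)[of i] in \<open>auto simp: restriction_def\<close>)
    then show "relatively_compactin (gtop G) (gen (R \<inter> restriction G (U' i)))"
      using relatively_compact_subset U(3) i by (metis less_Suc_eq_le)
  qed
  from mp[OF spec[OF RB, of U'] this] obtain W where W:
      "\<forall>c\<le>d. co (W c) \<and> W c \<subseteq> units G \<and> gen (K \<inter> restriction G (W c)) \<subseteq> B" "(\<Union>i<Suc N. U' i) \<subseteq> (\<Union>c\<le>d. W c)"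
    by (elim exE conjE)
  show "\<exists>U. (\<forall>i\<le>d. openin (unit_space G) (U i)) \<and> src G ` K0 \<union> rng G ` K0 \<subseteq> (\<Union>i\<le>d. U i) \<and>
      (\<forall>i\<le>d. relatively_compactin (gtop G) (gen (K0 \<inter> restriction G (U i))))"
  proof (intro exI[of _ W] conjI allI impI)
    show "openin (unit_space G) (W i)" if "i \<le> d" for i
      using W(1) that by (simp add: openin_unit_space compact_openin_def)
    have "K0 \<subseteq> arrows G" using K(1,3) co_subset by blast
    then have "src G ` K0 \<union> rng G ` K0 \<subseteq> units G" by auto
    then show "src G ` K0 \<union> rng G ` K0 \<subseteq> (\<Union>i\<le>d. W i)" using U'_cover W(2) by blast
    show "relatively_compactin (gtop G) (gen (K0 \<inter> restriction G (W i)))" if "i \<le> d" for i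
    proof (rule relatively_compact_subset[OF co_relatively_compact[OF B]])
      have "gen (K0 \<inter> restriction G (W i)) \<subseteq> gen (K \<inter> restriction G (W i))"
        by (rule gen_mono) (use K(3) in blast)
      then show "gen (K0 \<inter> restriction G (W i)) \<subseteq> B" using W(1) that by blast
    qed
  qed
qed

end

theorem theorem2:
  fixes G :: "'a groupoid"
  assumes "etale_groupoid G"
    and "sigma_compact_space (gtop G)"
    and "principal_groupoid G"
    and "compact_space (unit_space G)"
    and "totally_disconnected_space (unit_space G)"
  shows "asdim (arrows G) (canonical_coarse_structure G) \<le> dad G \<and>
         (dad G < \<infinity> \<longrightarrow> dad G = asdim (arrows G) (canonical_coarse_structure G))"
proof -
  interpret etale_groupoid G by (rule assms(1))
  interpret ample_groupoid G by unfold_locales (rule assms(4,5))+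
  let ?as = "asdim (arrows G) (canonical_coarse_structure G)"
  have le: "?as \<le> dad G"
    unfolding asdim_def dad_def
    by (rule INF_superset_mono) (use asdim_at_most_if_dad_at_most[OF assms(4)] in auto)
  moreover have "dad G \<le> ?as" if "dad G < \<infinity>"
  proof -
    obtain N where N: "dad_at_most G N"
    proof (rule ccontr)
      assume "\<not> thesis"
      then have "{d. dad_at_most G d} = {}" using that by blast
      then have "dad G = \<infinity>" unfolding dad_def by (simp only: image_empty Inf_empty top_enat_def)
      then show False using \<open>dad G < \<infinity>\<close> by simp
    qed
    then show ?thesis
      unfolding asdim_def dad_def
      by (intro INF_superset_mono) (use dad_at_most_if_asdim_at_most[OF assms(3)] in auto)
  qed
  ultimately show ?thesis by auto
qed

end
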